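(* Let $1\le k<n$ be integers and let $s\in[0,1]$. If $E\subset A(n,k)$ is a nonempty family of $k$-dimensional affine subspaces of $\mathbb{R}^n$ with $\dim E=s$, then $\dim\left(\bigcup_{P\in E}P\right)=s+k$.
   Context: $\dim$ denotes Hausdorff dimension. $A(n,k)$ denotes the space of all $k$-dimensional affine subspaces of $\mathbb{R}^n$. The Hausdorff dimension of a subset $E\subset A(n,k)$ is taken with respect to any natural metric $\rho$ on $A(n,k)$. Here $\rho$ is natural if it is strongly equivalent to the following metric $d$: write $P=V+a$, $P'=V'+a'$ with $V,V'$ $k$-dimensional linear subspaces, $a\in V^\perp$, $a'\in V'^\perp$, and put $d(P,P')=\|\pi_V-\pi_{V'}\|+|a-a'|$, where $\pi_V$ is the orthogonal projection onto $V$ and $\|\cdot\|$ is the operator norm; strongly equivalent means that there are constants $K_1,K_2>0$ with $K_1 d(P,P')\le\rho(P,P')\le K_2 d(P,P')$ for all $P,P'\in A(n,k)$. No measurability of $E$ is assumed. *)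

theory Defs
  imports "HOL-Analysis.Analysis"
begin

section \<open>Hausdorff dimension in a metric space\<close>

text \<open>The metric is an explicit parameter, in the style of the locale \<^locale>\<open>Metric_space\<close>,
  because the Hausdorff dimension is needed for several metrics on the same carrier. The diameter
  is extended-valued, since sets may be unbounded; \<^const>\<open>diameter\<close> is fixed to the
  type-class metric and is real-valued.\<close>

definition ediam :: "('a \<Rightarrow> 'a \<Rightarrow> real) \<Rightarrow> 'a set \<Rightarrow> ennreal" where
  "ediam d U = (SUP x\<in>U. SUP y\<in>U. ennreal (d x y))"

text \<open>The summand \<open>diam(U)\<^sup>t\<close>, with the usual conventions that the empty set contributes
  \<open>0\<close> and that \<open>0\<^sup>0 = 1\<close> for nonempty \<open>U\<close> (whereas \<open>0 powr 0 = 0\<close> in the library). It is only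
  used for sets of finite diameter.\<close>

definition diam_pow :: "('a \<Rightarrow> 'a \<Rightarrow> real) \<Rightarrow> real \<Rightarrow> 'a set \<Rightarrow> ennreal" where
  "diam_pow d t U =
     (if U = {} then 0 else if t = 0 then 1 else ennreal (enn2real (ediam d U) powr t))"

definition hausdorff_premeasure ::
    "'a set \<Rightarrow> ('a \<Rightarrow> 'a \<Rightarrow> real) \<Rightarrow> real \<Rightarrow> real \<Rightarrow> 'a set \<Rightarrow> ennreal" where
  "hausdorff_premeasure M d t \<delta> S =
     (INF U\<in>{U :: nat \<Rightarrow> 'a set. (\<forall>i. U i \<subseteq> M \<and> ediam d (U i) \<le> ennreal \<delta>) \<and> S \<subseteq> (\<Union>i. U i)}.
        \<Sum>i. diam_pow d t (U i))"

definition hausdorff_measure ::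
    "'a set \<Rightarrow> ('a \<Rightarrow> 'a \<Rightarrow> real) \<Rightarrow> real \<Rightarrow> 'a set \<Rightarrow> ennreal" where
  "hausdorff_measure M d t S = (SUP \<delta>\<in>{0<..}. hausdorff_premeasure M d t \<delta> S)"

definition hausdorff_dim :: "'a set \<Rightarrow> ('a \<Rightarrow> 'a \<Rightarrow> real) \<Rightarrow> 'a set \<Rightarrow> ennreal" where
  "hausdorff_dim M d S = Inf {ennreal t | t. 0 \<le> t \<and> hausdorff_measure M d t S = 0}"


section \<open>The space of affine subspaces and its natural metrics\<close>

definition affine_grassmannian :: "nat \<Rightarrow> (real ^ 'n) set set" where
  "affine_grassmannian k = {P. affine P \<and> aff_dim P = int k}"

definition orth_proj :: "(real ^ 'n) set \<Rightarrow> real ^ 'n \<Rightarrow> real ^ 'n" where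
  "orth_proj V x = (THE y. y \<in> V \<and> x - y \<in> V\<^sup>\<bottom>)"

text \<open>An affine subspace is \<open>P = V + a\<close> with \<open>V = direction P\<close> and \<open>a = foot P\<close>; see
  \<open>direction_translate\<close> and \<open>foot_translate\<close> below. For nonempty affine \<open>P\<close> the span is redundant;
  it makes the direction a linear subspace for every \<open>P\<close>, so that the metric below is
  nonnegative and symmetric off the carrier as well, as \<^locale>\<open>Metric_space\<close> requires.\<close>

definition direction :: "(real ^ 'n) set \<Rightarrow> (real ^ 'n) set" where
  "direction P = span {x - y | x y. x \<in> P \<and> y \<in> P}"

definition foot :: "(real ^ 'n) set \<Rightarrow> real ^ 'n" where
  "foot P = (THE a. a \<in> P \<and> a \<in> (direction P)\<^sup>\<bottom>)"

definition aff_dist :: "(real ^ 'n) set \<Rightarrow> (real ^ 'n) set \<Rightarrow> real" where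
  "aff_dist P Q = onorm (\<lambda>x. orth_proj (direction P) x - orth_proj (direction Q) x)
                  + norm (foot P - foot Q)"

definition natural_metric ::
    "nat \<Rightarrow> ((real ^ 'n) set \<Rightarrow> (real ^ 'n) set \<Rightarrow> real) \<Rightarrow> bool" where
  "natural_metric k \<rho> \<longleftrightarrow>
     Metric_space (affine_grassmannian k) \<rho> \<and>
     (\<exists>K1>0. \<exists>K2>0. \<forall>P\<in>affine_grassmannian k. \<forall>Q\<in>affine_grassmannian k.
        K1 * aff_dist P Q \<le> \<rho> P Q \<and> \<rho> P Q \<le> K2 * aff_dist P Q)"


section \<open>Basic facts\<close>

lemma orth_proj_unique:
  assumes "subspace V" "y \<in> V" "x - y \<in> V\<^sup>\<bottom>"
  shows "orth_proj V x = y"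
  unfolding orth_proj_def
proof (rule the_equality)
  show "y \<in> V \<and> x - y \<in> V\<^sup>\<bottom>" using assms by simp
next
  fix z assume z: "z \<in> V \<and> x - z \<in> V\<^sup>\<bottom>"
  have "z - y \<in> V" using z assms subspace_diff by blast
  moreover have "z - y \<in> V\<^sup>\<bottom>"
    using subspace_diff[OF subspace_orthogonal_comp assms(3), of "x - z"] z by simp
  ultimately have "orthogonal (z - y) (z - y)" by (auto simp: orthogonal_comp_def)
  then show "z = y" by (simp add: orthogonal_self)
qed

lemma orth_proj:
  fixes V :: "(real ^ 'n) set"
  assumes "subspace V"
  shows "orth_proj V x \<in> V" "x - orth_proj V x \<in> V\<^sup>\<bottom>"
proof -
  obtain y z where "y \<in> span V" "\<And>w. w \<in> span V \<Longrightarrow> orthogonal z w" "x = y + z"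
    using orthogonal_subspace_decomp_exists by metis
  moreover have "span V = V" using assms by (rule span_eq_iff[THEN iffD2])
  ultimately have *: "y \<in> V" "x - y \<in> V\<^sup>\<bottom>"
    by (auto simp: orthogonal_comp_def orthogonal_commute)
  with orth_proj_unique[OF assms *] show "orth_proj V x \<in> V" "x - orth_proj V x \<in> V\<^sup>\<bottom>"
    by auto
qed

lemma linear_orth_proj:
  fixes V :: "(real ^ 'n) set"
  assumes V: "subspace V"
  shows "linear (orth_proj V)"
proof (rule linearI)
  fix x y :: "real ^ 'n" and c :: real
  have "x + y - (orth_proj V x + orth_proj V y)
          = (x - orth_proj V x) + (y - orth_proj V y)" by simp
  also have "\<dots> \<in> V\<^sup>\<bottom>"
    by (intro subspace_add subspace_orthogonal_comp orth_proj V)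
  finally show "orth_proj V (x + y) = orth_proj V x + orth_proj V y"
    by (intro orth_proj_unique V subspace_add orth_proj)
  have "c *\<^sub>R x - c *\<^sub>R orth_proj V x = c *\<^sub>R (x - orth_proj V x)"
    by (simp add: scaleR_diff_right)
  also have "\<dots> \<in> V\<^sup>\<bottom>"
    by (intro subspace_scale subspace_orthogonal_comp orth_proj V)
  finally show "orth_proj V (c *\<^sub>R x) = c *\<^sub>R orth_proj V x"
    by (intro orth_proj_unique V subspace_scale orth_proj)
qed

lemma range_orth_proj:
  fixes V :: "(real ^ 'n) set"
  assumes "subspace V"
  shows "range (orth_proj V) = V"
proof -
  have "x \<in> range (orth_proj V)" if "x \<in> V" for x
    using orth_proj_unique[OF assms that, of x] subspace_0[OF subspace_orthogonal_comp, of V]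
    by (metis cancel_comm_monoid_add_class.diff_cancel rangeI)
  then show ?thesis using orth_proj(1)[OF assms] by auto
qed

lemma subspace_direction: "subspace (direction P)"
  by (simp add: direction_def)

lemma direction_translate:
  fixes V :: "(real ^ 'n) set"
  assumes "subspace V"
  shows "direction ((+) a ` V) = V"
proof -
  have "{x - y | x y. x \<in> (+) a ` V \<and> y \<in> (+) a ` V} = V"
  proof (intro equalityI subsetI)
    fix z assume "z \<in> {x - y | x y. x \<in> (+) a ` V \<and> y \<in> (+) a ` V}"
    then show "z \<in> V" using assms by (auto intro: subspace_diff)
  next
    fix z assume z: "z \<in> V"
    have "z = (a + z) - (a + 0)" "a + z \<in> (+) a ` V" "a + 0 \<in> (+) a ` V"
      using z subspace_0[OF assms] by (auto intro!: imageI simp del: add_0_right)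
    then show "z \<in> {x - y | x y. x \<in> (+) a ` V \<and> y \<in> (+) a ` V}" by blast
  qed
  then show ?thesis unfolding direction_def using assms by (simp add: span_eq_iff)
qed

lemma foot_translate:
  fixes V :: "(real ^ 'n) set"
  assumes "subspace V" "a \<in> V\<^sup>\<bottom>"
  shows "foot ((+) a ` V) = a"
  unfolding foot_def direction_translate[OF assms(1)]
proof (rule the_equality)
  show "a \<in> (+) a ` V \<and> a \<in> V\<^sup>\<bottom>"
    using assms subspace_0 by (force simp: image_iff)
next
  fix b assume b: "b \<in> (+) a ` V \<and> b \<in> V\<^sup>\<bottom>"
  then have "b - a \<in> V" by auto
  moreover have "b - a \<in> V\<^sup>\<bottom>" using b assms(2) subspace_diff subspace_orthogonal_comp by blast
  ultimately have "orthogonal (b - a) (b - a)" by (auto simp: orthogonal_comp_def)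
  then show "b = a" by (simp add: orthogonal_self)
qed

lemma affine_grassmannian_iff:
  fixes P :: "(real ^ 'n) set"
  shows "P \<in> affine_grassmannian k \<longleftrightarrow>
           (\<exists>V a. subspace V \<and> dim V = k \<and> a \<in> V\<^sup>\<bottom> \<and> P = (+) a ` V)"
proof
  assume P: "P \<in> affine_grassmannian k"
  then have "affine P" "P \<noteq> {}" by (auto simp: affine_grassmannian_def)
  then obtain V q where Vq: "subspace V" "V = (+) q ` P"
    using affine_parallel_subspace[of P] by (auto simp: affine_parallel_def)
  define p where "p = - q"
  have V: "subspace V" "P = (+) p ` V"
    using Vq by (auto simp: p_def image_image)
  let ?a = "p - orth_proj V p"
  have "P = (+) ?a ` V"
  proof (intro equalityI subsetI)
    fix x assume "x \<in> P"
    then obtain v where v: "v \<in> V" "x = p + v" using V by auto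
    then have "x = ?a + (orth_proj V p + v)" by simp
    then show "x \<in> (+) ?a ` V" using v V orth_proj(1)[OF V(1)] subspace_add by blast
  next
    fix x assume "x \<in> (+) ?a ` V"
    then obtain v where v: "v \<in> V" "x = ?a + v" by auto
    then have "x = p + (v - orth_proj V p)" by simp
    then show "x \<in> P" using v V orth_proj(1)[OF V(1)] subspace_diff by blast
  qed
  moreover have "dim V = k"
    using P V by (simp add: affine_grassmannian_def aff_dim_translation_eq aff_dim_subspace)
  ultimately show "\<exists>V a. subspace V \<and> dim V = k \<and> a \<in> V\<^sup>\<bottom> \<and> P = (+) a ` V"
    using V orth_proj(2)[OF V(1)] by blast
next
  assume "\<exists>V a. subspace V \<and> dim V = k \<and> a \<in> V\<^sup>\<bottom> \<and> P = (+) a ` V"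
  then show "P \<in> affine_grassmannian k"
    by (auto simp: affine_grassmannian_def aff_dim_translation_eq aff_dim_subspace
        affine_translation[symmetric] subspace_imp_affine)
qed

lemma aff_dist_translate:
  fixes V W :: "(real ^ 'n) set"
  assumes "subspace V" "a \<in> V\<^sup>\<bottom>" "subspace W" "b \<in> W\<^sup>\<bottom>"
  shows "aff_dist ((+) a ` V) ((+) b ` W)
           = onorm (\<lambda>x. orth_proj V x - orth_proj W x) + norm (a - b)"
  using assms by (simp add: aff_dist_def direction_translate foot_translate)

lemma bounded_linear_orth_proj_diff:
  "bounded_linear (\<lambda>x. orth_proj (direction P) x - orth_proj (direction Q) x)"
  by (intro bounded_linear_sub linear_conv_bounded_linear[THEN iffD1]
      linear_orth_proj subspace_direction)

lemma Metric_space_aff_dist: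
  "Metric_space (affine_grassmannian k :: (real ^ 'n) set set) aff_dist"
proof
  fix P Q R :: "(real ^ 'n) set"
  show "0 \<le> aff_dist P Q"
    unfolding aff_dist_def
    by (intro add_nonneg_nonneg onorm_pos_le bounded_linear_orth_proj_diff norm_ge_zero)
  show "aff_dist P Q = aff_dist Q P"
    unfolding aff_dist_def
    using onorm_neg[of "\<lambda>x. orth_proj (direction P) x - orth_proj (direction Q) x"]
    by (simp add: norm_minus_commute)
  have "onorm (\<lambda>x. orth_proj (direction P) x - orth_proj (direction R) x)
      \<le> onorm (\<lambda>x. orth_proj (direction P) x - orth_proj (direction Q) x)
        + onorm (\<lambda>x. orth_proj (direction Q) x - orth_proj (direction R) x)"
    using onorm_triangle[OF bounded_linear_orth_proj_diff[of P Q] bounded_linear_orth_proj_diff[of Q R]]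
    by simp
  moreover have "norm (foot P - foot R) \<le> norm (foot P - foot Q) + norm (foot Q - foot R)"
    by (metis dist_norm dist_triangle)
  ultimately show "aff_dist P R \<le> aff_dist P Q + aff_dist Q R"
    unfolding aff_dist_def by linarith
  assume "P \<in> affine_grassmannian k" "Q \<in> affine_grassmannian k"
  then obtain V a W b where
    P: "subspace V" "a \<in> V\<^sup>\<bottom>" "P = (+) a ` V" and Q: "subspace W" "b \<in> W\<^sup>\<bottom>" "Q = (+) b ` W"
    by (auto simp: affine_grassmannian_iff)
  have bl: "bounded_linear (\<lambda>x. orth_proj V x - orth_proj W x)"
    by (intro bounded_linear_sub linear_conv_bounded_linear[THEN iffD1] linear_orth_proj P Q)
  have eq: "aff_dist P Q = onorm (\<lambda>x. orth_proj V x - orth_proj W x) + norm (a - b)"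
    using P Q aff_dist_translate by blast
  show "aff_dist P Q = 0 \<longleftrightarrow> P = Q"
  proof
    assume "aff_dist P Q = 0"
    then have 0: "onorm (\<lambda>x. orth_proj V x - orth_proj W x) = 0" "a = b"
      using eq onorm_pos_le[OF bl] by (simp_all add: add_nonneg_eq_0_iff)
    then have "orth_proj V = orth_proj W"
      using onorm_eq_0[OF bl] 0(1) by (auto simp: fun_eq_iff)
    then have "V = W" using range_orth_proj P Q by metis
    then show "P = Q" using P Q 0 by simp
  next
    assume "P = Q"
    then show "aff_dist P Q = 0" by (simp add: aff_dist_def onorm_zero)
  qed
qed

lemma natural_metric_aff_dist: "natural_metric k aff_dist"
  unfolding natural_metric_def using Metric_space_aff_dist by (auto intro!: exI[of _ 1])

end

theory Submission
  imports Defs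
begin

text \<open>Only the vanishing of Hausdorff measures matters, and a set has vanishing measure of exponent
  \<open>t > 0\<close> precisely if it has countable covers with arbitrarily small sum of \<open>t\<close>-th powers of radii.
  This property is insensitive to a strongly equivalent change of metric and is stable under countable
  unions.

  For the upper bound, a set of planes of diameter \<open>r\<close> sweeps out, within a fixed ball, a
  neighbourhood of one plane of width comparable to \<open>r\<close>, which is covered by about \<open>1 / r\<^sup>k\<close> sets of
  diameter comparable to \<open>r\<close>; a cover of \<open>E\<close> with exponent \<open>t\<close> thus becomes a cover of the union with
  exponent \<open>t + k\<close> (\<open>null_at_union_of_planes\<close>).

  For the lower bound, let \<open>t < 1\<close> and \<open>u < t + k\<close>, and suppose that the union has cheap covers with
  exponent \<open>u\<close>. Write the planes as graphs \<open>x \<mapsto> A x + b\<close> over \<open>k\<close> coordinates. Two graphs of planes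
  at distance \<open>\<rho>\<close> are \<open>r\<close>-close only on a set of \<open>x\<close> of measure at most of order \<open>r / \<rho>\<close>
  (\<open>measure_affine_sublevel\<close> and \<open>aff_dist_le_graph_dist\<close>). By pigeonholing, each plane spends a
  substantial part of its graph in the covering balls of a single dyadic scale \<open>\<delta>\<close>. Among the planes
  belonging to one scale, a set with at most \<open>2\<^sup>i\<^sup>t\<close> members in every ball of radius \<open>2\<^sup>i \<delta>\<close> has
  bounded pair correlation because \<open>t < 1\<close>, and a second moment argument bounds its cardinality by
  the number of covering balls of that scale times \<open>\<delta>\<^sup>k\<close>, up to a factor that depends
  on the share of the graphs (\<open>single_scale_bound\<close>). Taking such a set
  with the largest cardinality, one obtains from Vitali's selection an economical cover of all planes of
  this scale (\<open>cover_by_spread_bound\<close>). Such sets are a discrete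
  substitute for a Frostman measure and exist in arbitrary sets. Summing over the scales shows that \<open>E\<close> has
  cheap covers with exponent \<open>t\<close> (\<open>null_at_of_null_union\<close>), so \<open>t\<close> is at least the dimension of \<open>E\<close>.
  For a family of dimension \<open>0\<close> it suffices that a single \<open>k\<close>-plane has dimension at least \<open>k\<close>
  (\<open>not_null_at_plane\<close>).\<close>


section \<open>Covers and vanishing Hausdorff measure\<close>

text \<open>For positive exponents this says that the Hausdorff measure vanishes. The radii \<open>r i\<close> are upper
  bounds for the diameters and are strictly positive, so that negative powers of them make sense;
  the total is controlled through finite partial sums, so that covers can be regrouped within the
  reals.\<close>

definition null_at :: "'a set \<Rightarrow> ('a \<Rightarrow> 'a \<Rightarrow> real) \<Rightarrow> real \<Rightarrow> 'a set \<Rightarrow> bool" where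
  "null_at M d t S \<longleftrightarrow> (\<forall>\<epsilon>>0. \<exists>(U :: nat \<Rightarrow> 'a set) r.
     (\<forall>i. U i \<subseteq> M \<and> 0 < r i \<and> (\<forall>x\<in>U i. \<forall>y\<in>U i. d x y \<le> r i)) \<and> S \<subseteq> (\<Union>i. U i) \<and>
     (\<forall>F. finite F \<longrightarrow> (\<Sum>i\<in>F. r i powr t) \<le> \<epsilon>))"

lemma ediam_le_iff:
  assumes "0 \<le> r"
  shows "ediam d U \<le> ennreal r \<longleftrightarrow> (\<forall>x\<in>U. \<forall>y\<in>U. d x y \<le> r)"
  using assms by (auto simp: ediam_def SUP_le_iff ennreal_le_iff)

lemma null_atE:
  assumes "null_at M d t S" "0 < \<epsilon>"
  obtains U :: "nat \<Rightarrow> 'a set" and r where "\<And>i. U i \<subseteq> M" "\<And>i. 0 < r i"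
       "\<And>i x y. x \<in> U i \<Longrightarrow> y \<in> U i \<Longrightarrow> d x y \<le> r i" "S \<subseteq> (\<Union>i. U i)"
       "\<And>F. finite F \<Longrightarrow> (\<Sum>i\<in>F. r i powr t) \<le> \<epsilon>"
proof -
  obtain U :: "nat \<Rightarrow> 'a set" and r where
     "\<forall>i. U i \<subseteq> M \<and> 0 < r i \<and> (\<forall>x\<in>U i. \<forall>y\<in>U i. d x y \<le> r i)" "S \<subseteq> (\<Union>i. U i)"
     "\<forall>F. finite F \<longrightarrow> (\<Sum>i\<in>F. r i powr t) \<le> \<epsilon>"
    using assms(1)[unfolded null_at_def, rule_format, OF assms(2)] by (elim exE conjE) (rule that)
  then show ?thesis by (intro that[of U r]) auto
qed

text \<open>A cover may be indexed by any countable set and may use radius \<open>0\<close>: half of \<open>\<epsilon>\<close> is spent on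
  making the radii positive.\<close>

lemma null_atI:
  assumes t: "0 < t"
    and cov: "\<And>\<epsilon>. 0 < \<epsilon> \<Longrightarrow> \<exists>(J :: 'b set) U r. countable J \<and>
       (\<forall>j\<in>J. U j \<subseteq> M \<and> 0 \<le> r j \<and> (\<forall>x\<in>U j. \<forall>y\<in>U j. d x y \<le> r j)) \<and> S \<subseteq> (\<Union>j\<in>J. U j) \<and>
       (\<forall>F. finite F \<longrightarrow> F \<subseteq> J \<longrightarrow> (\<Sum>j\<in>F. r j powr t) \<le> \<epsilon>)"
  shows "null_at M d t S"
  unfolding null_at_def
proof (intro allI impI)
  fix \<epsilon> :: real assume \<epsilon>: "0 < \<epsilon>"
  obtain J :: "'b set" and U r where J: "countable J"
    and Ur: "\<forall>j\<in>J. U j \<subseteq> M \<and> 0 \<le> r j \<and> (\<forall>x\<in>U j. \<forall>y\<in>U j. d x y \<le> r j)"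
    and S: "S \<subseteq> (\<Union>j\<in>J. U j)"
    and sums: "\<forall>F. finite F \<longrightarrow> F \<subseteq> J \<longrightarrow> (\<Sum>j\<in>F. r j powr t) \<le> \<epsilon> / 2"
    using cov[OF half_gt_zero[OF \<epsilon>]] by (elim exE conjE) (rule that)
  have U: "U j \<subseteq> M" and r: "0 \<le> r j" and d: "\<And>x y. x \<in> U j \<Longrightarrow> y \<in> U j \<Longrightarrow> d x y \<le> r j"
    if "j \<in> J" for j using Ur that by auto
  have sum: "(\<Sum>j\<in>F. r j powr t) \<le> \<epsilon> / 2" if "finite F" "F \<subseteq> J" for F using sums that by simp
  define g where "g = to_nat_on J"
  have inj: "inj_on g J" using J unfolding g_def by (rule inj_on_to_nat_on)
  define h where "h = inv_into J g"
  define V where "V i = (if i \<in> g ` J then U (h i) else {})" for i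
  define s where "s i = (if i \<in> g ` J then r (h i) else 0)" for i
  \<comment> \<open>The slack makes every radius positive.\<close>
  define R where "R i = (s i powr t + \<epsilon> / 2 * (1/2) ^ Suc i) powr (1 / t)" for i
  have hJ: "h i \<in> J" if "i \<in> g ` J" for i using that by (simp add: h_def inv_into_into)
  have s0: "0 \<le> s i" for i using r hJ by (auto simp: s_def)
  have pos: "0 < s i powr t + \<epsilon> / 2 * (1/2) ^ Suc i" for i
    using \<epsilon> by (intro add_nonneg_pos) auto
  have Rp: "0 < R i" for i using pos[of i] by (simp add: R_def)
  have Rt: "R i powr t = s i powr t + \<epsilon> / 2 * (1/2) ^ Suc i" for i
    using t pos[of i] by (simp add: R_def powr_powr)
  have sR: "s i \<le> R i" for i
  proof -
    have "s i = (s i powr t) powr (1 / t)" using t s0[of i] by (simp add: powr_powr)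
    also have "\<dots> \<le> R i"
      unfolding R_def using t \<epsilon> by (intro powr_mono2) auto
    finally show ?thesis .
  qed
  have sumR: "(\<Sum>i\<in>F. R i powr t) \<le> \<epsilon>" if F: "finite F" for F :: "nat set"
  proof -
    have "(\<Sum>i\<in>F. s i powr t) = (\<Sum>i\<in>F \<inter> g ` J. s i powr t)"
      using F by (intro sum.mono_neutral_right) (auto simp: s_def)
    also have "\<dots> = (\<Sum>i\<in>F \<inter> g ` J. r (h i) powr t)"
      by (intro sum.cong) (auto simp: s_def)
    also have "\<dots> = (\<Sum>j\<in>h ` (F \<inter> g ` J). r j powr t)"
    proof (subst sum.reindex)
      show "inj_on h (F \<inter> g ` J)"
        unfolding h_def by (rule inj_on_subset[OF inj_on_inv_into[of "g ` J" g J]]) auto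
    qed simp
    also have "\<dots> \<le> \<epsilon> / 2" using F hJ by (intro sum) auto
    finally have 1: "(\<Sum>i\<in>F. s i powr t) \<le> \<epsilon> / 2" .
    have "(\<Sum>i\<in>F. (1/2::real) ^ Suc i) \<le> (\<Sum>i. (1/2) ^ Suc i)"
      using F sums_summable[OF power_half_series] by (intro sum_le_suminf) auto
    also have "\<dots> = 1" using power_half_series sums_unique by metis
    finally have "\<epsilon> / 2 * (\<Sum>i\<in>F. (1/2::real) ^ Suc i) \<le> \<epsilon> / 2 * 1"
      using \<epsilon> by (intro mult_left_mono) auto
    with 1 show ?thesis by (simp add: Rt sum.distrib sum_distrib_left)
  qed
  have cover: "S \<subseteq> (\<Union>i. V i)"
  proof
    fix x assume "x \<in> S"
    then obtain j where j: "j \<in> J" "x \<in> U j" using S by auto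
    then have "x \<in> V (g j)" by (auto simp: V_def h_def inv_into_f_f[OF inj])
    then show "x \<in> (\<Union>i. V i)" by auto
  qed
  have "V i \<subseteq> M \<and> 0 < R i \<and> (\<forall>x\<in>V i. \<forall>y\<in>V i. d x y \<le> R i)" for i
  proof (cases "i \<in> g ` J")
    case True
    have "d x y \<le> R i" if "x \<in> V i" "y \<in> V i" for x y
      using that True d[OF hJ[OF True], of x y] sR[of i] by (auto simp: V_def s_def)
    then show ?thesis using Rp U[OF hJ[OF True]] True by (auto simp: V_def)
  qed (auto simp: V_def Rp)
  with cover sumR show "\<exists>(U :: nat \<Rightarrow> 'a set) r.
     (\<forall>i. U i \<subseteq> M \<and> 0 < r i \<and> (\<forall>x\<in>U i. \<forall>y\<in>U i. d x y \<le> r i)) \<and> S \<subseteq> (\<Union>i. U i) \<and>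
     (\<forall>F. finite F \<longrightarrow> (\<Sum>i\<in>F. r i powr t) \<le> \<epsilon>)" by blast
qed

text \<open>A cover whose \<open>t\<close>-th powers sum to less than \<open>\<delta>\<^sup>t\<close> automatically consists of sets of diameter
  at most \<open>\<delta>\<close>, so the supremum over \<open>\<delta>\<close> does not matter for the vanishing of the measure.\<close>

lemma hausdorff_measure_eq_0_iff:
  assumes t: "0 < t"
  shows "hausdorff_measure M d t S = 0 \<longleftrightarrow> null_at M d t S"
proof
  assume "hausdorff_measure M d t S = 0"
  then have "(SUP \<delta>\<in>{0<..}. hausdorff_premeasure M d t \<delta> S) \<le> 0"
    by (simp add: hausdorff_measure_def)
  then have H: "hausdorff_premeasure M d t 1 S = 0"
    unfolding SUP_le_iff by auto
  show "null_at M d t S"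
  proof (rule null_atI[OF t])
    fix \<epsilon> :: real assume "0 < \<epsilon>"
    then have "hausdorff_premeasure M d t 1 S < ennreal \<epsilon>" using H by simp
    then obtain U :: "nat \<Rightarrow> 'a set" where U: "\<And>i. U i \<subseteq> M" "\<And>i. ediam d (U i) \<le> ennreal 1"
        "S \<subseteq> (\<Union>i. U i)" "(\<Sum>i. diam_pow d t (U i)) < ennreal \<epsilon>"
      unfolding hausdorff_premeasure_def INF_less_iff by auto
    define r where "r i = enn2real (ediam d (U i))" for i
    have fin: "ediam d (U i) = ennreal (r i)" for i
      using U(2)[of i] unfolding r_def by (metis ennreal_enn2real ennreal_less_top leD top.not_eq_extremum le_less_trans)
    have r0: "0 \<le> r i" for i by (simp add: r_def)
    have "(\<Sum>i\<in>F. r i powr t) \<le> \<epsilon>" if F: "finite F" for F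
    proof -
      have "ennreal (\<Sum>i\<in>F. r i powr t) = (\<Sum>i\<in>F. ennreal (r i powr t))"
        by (simp add: sum_ennreal)
      also have "\<dots> = (\<Sum>i\<in>F. diam_pow d t (U i))"
      proof (rule sum.cong)
        fix i
        have "r i = 0" if "U i = {}" using that by (simp add: r_def ediam_def bot_ennreal)
        then show "ennreal (r i powr t) = diam_pow d t (U i)"
          using t by (auto simp: diam_pow_def r_def)
      qed simp
      also have "\<dots> \<le> (\<Sum>i. diam_pow d t (U i))"
        using F by (intro sum_le_suminf) auto
      also have "\<dots> \<le> ennreal \<epsilon>" using U(4) by simp
      finally show ?thesis using \<open>0 < \<epsilon>\<close> by (simp add: ennreal_le_iff)
    qed
    moreover have "\<forall>x\<in>U i. \<forall>y\<in>U i. d x y \<le> r i" for i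
      using fin[of i] ediam_le_iff[OF r0, of d "U i" i] by simp
    ultimately show "\<exists>(J :: nat set) U r. countable J \<and>
       (\<forall>j\<in>J. U j \<subseteq> M \<and> 0 \<le> r j \<and> (\<forall>x\<in>U j. \<forall>y\<in>U j. d x y \<le> r j)) \<and> S \<subseteq> (\<Union>j\<in>J. U j) \<and>
       (\<forall>F. finite F \<longrightarrow> F \<subseteq> J \<longrightarrow> (\<Sum>j\<in>F. r j powr t) \<le> \<epsilon>)"
      using U r0 by (intro exI[of _ UNIV] exI[of _ U] exI[of _ r]) auto
  qed
next
  assume N: "null_at M d t S"
  have "hausdorff_premeasure M d t \<delta> S \<le> 0 + ennreal \<epsilon>" if \<delta>: "0 < \<delta>" and \<epsilon>: "0 < \<epsilon>" for \<delta> \<epsilon>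
  proof -
    define \<epsilon>' where "\<epsilon>' = min \<epsilon> (\<delta> powr t)"
    have e: "0 < \<epsilon>'" using \<epsilon> \<delta> by (simp add: \<epsilon>'_def)
    obtain U :: "nat \<Rightarrow> 'a set" and r where U: "\<And>i. U i \<subseteq> M" "\<And>i. 0 < r i"
       "\<And>i x y. x \<in> U i \<Longrightarrow> y \<in> U i \<Longrightarrow> d x y \<le> r i" "S \<subseteq> (\<Union>i. U i)"
       and s: "\<And>F. finite F \<Longrightarrow> (\<Sum>i\<in>F. r i powr t) \<le> \<epsilon>'"
      by (rule null_atE[OF N e]) (rule that)
    have rd: "r i \<le> \<delta>" for i
    proof (rule ccontr)
      assume "\<not> r i \<le> \<delta>"
      then have "\<delta> powr t < r i powr t" using t \<delta> by (intro powr_less_mono2) auto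
      moreover have "r i powr t \<le> \<delta> powr t" using s[of "{i}"] by (simp add: \<epsilon>'_def)
      ultimately show False by simp
    qed
    have e: "ediam d (U i) \<le> ennreal (r i)" for i
      using U(2)[of i] U(3) by (subst ediam_le_iff) auto
    have ed: "ediam d (U i) \<le> ennreal \<delta>" for i
      using e[of i] rd[of i] by (meson ennreal_leI order_trans)
    have dp: "diam_pow d t (U i) \<le> ennreal (r i powr t)" for i
    proof -
      have "enn2real (ediam d (U i)) \<le> r i"
        using e[of i] U(2)[of i] by (simp add: enn2real_leI)
      then show ?thesis using t by (auto simp: diam_pow_def intro!: ennreal_leI powr_mono2)
    qed
    have "(\<Sum>i. diam_pow d t (U i)) \<le> (\<Sum>i. ennreal (r i powr t))"
      by (intro suminf_le dp) auto
    also have "\<dots> \<le> ennreal \<epsilon>'"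
    proof (rule suminf_le_const)
      fix n show "(\<Sum>i<n. ennreal (r i powr t)) \<le> ennreal \<epsilon>'"
        using s[of "{..<n}"] by (simp add: sum_ennreal ennreal_leI)
    qed auto
    also have "\<dots> \<le> ennreal \<epsilon>" by (intro ennreal_leI) (simp add: \<epsilon>'_def)
    finally have "(\<Sum>i. diam_pow d t (U i)) \<le> ennreal \<epsilon>" .
    moreover have "hausdorff_premeasure M d t \<delta> S \<le> (\<Sum>i. diam_pow d t (U i))"
      unfolding hausdorff_premeasure_def using U ed by (intro INF_lower) auto
    ultimately show ?thesis by simp
  qed
  note prem = this
  have "hausdorff_premeasure M d t \<delta> S \<le> 0" if "0 < \<delta>" for \<delta>
    by (rule ennreal_le_epsilon) (rule prem[OF that])
  then show "hausdorff_measure M d t S = 0"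
    unfolding hausdorff_measure_def le_zero_eq[symmetric] SUP_le_iff by auto
qed

text \<open>At exponent \<open>0\<close> every nonempty set of a cover costs \<open>1\<close>.\<close>

lemma hausdorff_measure_0_eq_0_iff: "hausdorff_measure M d 0 S = 0 \<longleftrightarrow> S = {}"
proof
  assume "hausdorff_measure M d 0 S = 0"
  then have "(SUP \<delta>\<in>{0<..}. hausdorff_premeasure M d 0 \<delta> S) \<le> 0"
    by (simp add: hausdorff_measure_def)
  then have H: "hausdorff_premeasure M d 0 1 S < 1"
    unfolding SUP_le_iff by (force intro: le_less_trans)
  then obtain U :: "nat \<Rightarrow> 'a set" where U: "S \<subseteq> (\<Union>i. U i)" "(\<Sum>i. diam_pow d 0 (U i)) < 1"
    unfolding hausdorff_premeasure_def INF_less_iff by auto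
  have "U i = {}" for i
  proof (rule ccontr)
    assume "U i \<noteq> {}"
    then have "1 = (\<Sum>j\<in>{i}. diam_pow d 0 (U j))" by (simp add: diam_pow_def)
    also have "\<dots> \<le> (\<Sum>i. diam_pow d 0 (U i))" by (intro sum_le_suminf) auto
    finally show False using U(2) by simp
  qed
  then show "S = {}" using U by auto
next
  assume S: "S = {}"
  have "hausdorff_premeasure M d 0 \<delta> S \<le> 0" for \<delta>
  proof -
    have "hausdorff_premeasure M d 0 \<delta> S \<le> (\<Sum>i::nat. diam_pow d 0 ({} :: 'a set))"
      unfolding hausdorff_premeasure_def using S
      by (intro INF_lower) (auto simp: ediam_def)
    then show ?thesis by (simp add: diam_pow_def)
  qed
  then show "hausdorff_measure M d 0 S = 0"
    unfolding hausdorff_measure_def le_zero_eq[symmetric] SUP_le_iff by auto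
qed

lemma null_at_UN:
  assumes t: "0 < t" and N: "\<And>m::nat. null_at M d t (S m)"
  shows "null_at M d t (\<Union>m. S m)"
proof (rule null_atI[OF t])
  fix \<epsilon> :: real assume \<epsilon>: "0 < \<epsilon>"
  have "\<exists>(U :: nat \<Rightarrow> 'a set) r.
     (\<forall>i. U i \<subseteq> M \<and> 0 < r i \<and> (\<forall>x\<in>U i. \<forall>y\<in>U i. d x y \<le> r i)) \<and> S m \<subseteq> (\<Union>i. U i) \<and>
     (\<forall>F. finite F \<longrightarrow> (\<Sum>i\<in>F. r i powr t) \<le> \<epsilon> * (1/2) ^ Suc m)" for m
    using N[of m, unfolded null_at_def, rule_format, of "\<epsilon> * (1/2) ^ Suc m"] \<epsilon> by simp
  then obtain U :: "nat \<Rightarrow> nat \<Rightarrow> 'a set" and r where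
    U: "\<And>m i. U m i \<subseteq> M" "\<And>m i. 0 < r m i" "\<And>m i. \<forall>x\<in>U m i. \<forall>y\<in>U m i. d x y \<le> r m i"
       "\<And>m. S m \<subseteq> (\<Union>i. U m i)"
    and s: "\<And>m F. finite F \<Longrightarrow> (\<Sum>i\<in>F. r m i powr t) \<le> \<epsilon> * (1/2) ^ Suc m"
    by metis
  have sum: "(\<Sum>j\<in>F. r (fst j) (snd j) powr t) \<le> \<epsilon>" if F: "finite F" for F
  proof -
    have "(\<Sum>j\<in>F. r (fst j) (snd j) powr t) \<le> (\<Sum>j\<in>fst ` F \<times> snd ` F. r (fst j) (snd j) powr t)"
      using F by (intro sum_mono2) (auto intro: rev_image_eqI)
    also have "\<dots> = (\<Sum>m\<in>fst ` F. \<Sum>i\<in>snd ` F. r m i powr t)"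
      by (subst sum.cartesian_product) (simp add: case_prod_beta)
    also have "\<dots> \<le> (\<Sum>m\<in>fst ` F. \<epsilon> * (1/2) ^ Suc m)" using F by (intro sum_mono s) auto
    also have "\<dots> \<le> (\<Sum>m. \<epsilon> * (1/2) ^ Suc m)"
      using F \<epsilon> summable_mult[OF sums_summable[OF power_half_series], of \<epsilon>]
      by (intro sum_le_suminf) auto
    also have "\<dots> = \<epsilon>" using sums_unique[OF sums_mult[OF power_half_series, of \<epsilon>]] by simp
    finally show ?thesis .
  qed
  show "\<exists>(J :: (nat \<times> nat) set) U r. countable J \<and>
       (\<forall>j\<in>J. U j \<subseteq> M \<and> 0 \<le> r j \<and> (\<forall>x\<in>U j. \<forall>y\<in>U j. d x y \<le> r j)) \<and> (\<Union>m. S m) \<subseteq> (\<Union>j\<in>J. U j) \<and>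
       (\<forall>F. finite F \<longrightarrow> F \<subseteq> J \<longrightarrow> (\<Sum>j\<in>F. r j powr t) \<le> \<epsilon>)"
  proof (intro exI[of _ UNIV] exI[of _ "\<lambda>j. U (fst j) (snd j)"] exI[of _ "\<lambda>j. r (fst j) (snd j)"] conjI)
    show "(\<Union>m. S m) \<subseteq> (\<Union>j\<in>UNIV. U (fst j) (snd j))" using U(4) by fastforce
  qed (use U(1-3) sum in \<open>auto simp: less_imp_le\<close>)
qed

lemma null_at_UN_countable:
  assumes t: "0 < t" and A: "countable A" and N: "\<And>a. a \<in> A \<Longrightarrow> null_at M d t (S a)"
  shows "null_at M d t (\<Union>a\<in>A. S a)"
proof (cases "A = {}")
  case True
  have "null_at M d t {}"
  proof (rule null_atI[OF t])
    fix \<epsilon> :: real assume "0 < \<epsilon>"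
    then show "\<exists>(J :: nat set) U r. countable J \<and>
       (\<forall>j\<in>J. U j \<subseteq> M \<and> 0 \<le> r j \<and> (\<forall>x\<in>U j. \<forall>y\<in>U j. d x y \<le> r j)) \<and> {} \<subseteq> (\<Union>j\<in>J. U j) \<and>
       (\<forall>F. finite F \<longrightarrow> F \<subseteq> J \<longrightarrow> (\<Sum>j\<in>F. r j powr t) \<le> \<epsilon>)"
      by (intro exI[of _ "{}"]) auto
  qed
  then show ?thesis using True by simp
next
  case False
  have "null_at M d t (\<Union>m. S (from_nat_into A m))"
    using False N by (intro null_at_UN t) (auto intro: from_nat_into)
  moreover have "(\<Union>m. S (from_nat_into A m)) = (\<Union>a\<in>A. S a)"
    using range_from_nat_into[OF False A] by (metis image_image)
  ultimately show ?thesis by simp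
qed

lemma null_at_subset: "null_at M d t S \<Longrightarrow> T \<subseteq> S \<Longrightarrow> null_at M d t T"
  unfolding null_at_def by (elim all_forward imp_forward ex_forward) auto

lemma null_at_lipschitz:
  assumes t: "0 < t" and K: "0 < K" and N: "null_at M d t S" and MM: "M \<subseteq> M'"
    and le: "\<And>x y. x \<in> M \<Longrightarrow> y \<in> M \<Longrightarrow> d' x y \<le> K * d x y"
  shows "null_at M' d' t S"
  unfolding null_at_def
proof (intro allI impI)
  fix \<epsilon> :: real assume \<epsilon>: "0 < \<epsilon>"
  then have e: "0 < \<epsilon> / K powr t" using K by simp
  obtain U :: "nat \<Rightarrow> 'a set" and r where U: "\<And>i. U i \<subseteq> M" "\<And>i. 0 < r i"
       "\<And>i x y. x \<in> U i \<Longrightarrow> y \<in> U i \<Longrightarrow> d x y \<le> r i" "S \<subseteq> (\<Union>i. U i)"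
       and s: "\<And>F. finite F \<Longrightarrow> (\<Sum>i\<in>F. r i powr t) \<le> \<epsilon> / K powr t"
      by (rule null_atE[OF N e]) (rule that)
  have "(\<Sum>i\<in>F. (K * r i) powr t) \<le> \<epsilon>" if "finite F" for F
    using s[OF that] K U(2) by (simp add: powr_mult less_imp_le sum_distrib_left[symmetric] field_simps)
  moreover have "d' x y \<le> K * r i" if "x \<in> U i" "y \<in> U i" for i x y
    using le[of x y] U(1)[of i] U(3)[OF that] that K
    by (meson mult_left_mono less_imp_le order_trans subsetD)
  ultimately show "\<exists>(U :: nat \<Rightarrow> 'a set) r.
     (\<forall>i. U i \<subseteq> M' \<and> 0 < r i \<and> (\<forall>x\<in>U i. \<forall>y\<in>U i. d' x y \<le> r i)) \<and> S \<subseteq> (\<Union>i. U i) \<and>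
     (\<forall>F. finite F \<longrightarrow> (\<Sum>i\<in>F. r i powr t) \<le> \<epsilon>)"
    using U(2,4) K subset_trans[OF U(1) MM] by (intro exI[of _ U] exI[of _ "\<lambda>i. K * r i"]) simp
qed

lemma null_at_mono_exponent:
  assumes "0 < t" "t \<le> t'" "null_at M d t S"
  shows "null_at M d t' S"
  unfolding null_at_def
proof (intro allI impI)
  fix \<epsilon> :: real assume "0 < \<epsilon>"
  then have e: "0 < min 1 \<epsilon>" by simp
  obtain U :: "nat \<Rightarrow> 'a set" and r where U: "\<And>i. U i \<subseteq> M" "\<And>i. 0 < r i"
       "\<And>i x y. x \<in> U i \<Longrightarrow> y \<in> U i \<Longrightarrow> d x y \<le> r i" "S \<subseteq> (\<Union>i. U i)"
       and s: "\<And>F. finite F \<Longrightarrow> (\<Sum>i\<in>F. r i powr t) \<le> min 1 \<epsilon>"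
      by (rule null_atE[OF assms(3) e]) (rule that)
  have "r i \<le> 1" for i
  proof (rule ccontr)
    assume "\<not> r i \<le> 1"
    then have "1 < r i powr t" using assms(1) by (simp add: gr_one_powr)
    then show False using s[of "{i}"] by simp
  qed
  then have "r i powr t' \<le> r i powr t" for i
    using U(2)[of i] assms(2) by (intro powr_mono') (simp_all add: less_imp_le)
  then have "(\<Sum>i\<in>F. r i powr t') \<le> \<epsilon>" if "finite F" for F
    using s[OF that] sum_mono[of F "\<lambda>i. r i powr t'" "\<lambda>i. r i powr t"] by force
  then show "\<exists>(U :: nat \<Rightarrow> 'a set) r.
     (\<forall>i. U i \<subseteq> M \<and> 0 < r i \<and> (\<forall>x\<in>U i. \<forall>y\<in>U i. d x y \<le> r i)) \<and> S \<subseteq> (\<Union>i. U i) \<and>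
     (\<forall>F. finite F \<longrightarrow> (\<Sum>i\<in>F. r i powr t') \<le> \<epsilon>)"
    using U by (intro exI[of _ U] exI[of _ r]) auto
qed


section \<open>Spread sets and pair correlations\<close>

text \<open>The selection in Vitali's covering lemma only needs to know which sets meet and which is larger;
  here the sets are traces of balls on a finite set, so that greedy removal of a set of maximal rank
  terminates although the family itself may be infinite.\<close>

lemma vitali_selection:
  fixes T :: "'b \<Rightarrow> 'p set" and rank :: "'b \<Rightarrow> nat"
  assumes "finite P" "\<And>b. b \<in> B \<Longrightarrow> T b \<subseteq> P" "\<And>b. b \<in> B \<Longrightarrow> T b \<noteq> {}" "\<And>b. b \<in> B \<Longrightarrow> rank b \<le> L"
  shows "\<exists>C. C \<subseteq> B \<and> finite C \<and> disjoint_family_on T C \<and>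
           (\<forall>b\<in>B. \<exists>c\<in>C. T b \<inter> T c \<noteq> {} \<and> rank b \<le> rank c)"
  using assms
proof (induction "card P" arbitrary: P B rule: less_induct)
  case less
  show ?case
  proof (cases "B = {}")
    case True
    then show ?thesis by (intro exI[of _ "{}"]) (auto simp: disjoint_family_on_def)
  next
    case False
    have "finite (rank ` B)" using less.prems(4) by (auto intro!: finite_subset[of _ "{..L}"])
    then have "Max (rank ` B) \<in> rank ` B" "\<And>b. b \<in> B \<Longrightarrow> rank b \<le> Max (rank ` B)"
      using False by auto
    then obtain b0 where b0: "b0 \<in> B" "\<And>b. b \<in> B \<Longrightarrow> rank b \<le> rank b0"
      by auto
    define B' where "B' = {b \<in> B. T b \<inter> T b0 = {}}"
    have "card (P - T b0) < card P"
      using less.prems(1) less.prems(2,3)[OF b0(1)] by (intro psubset_card_mono) auto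
    moreover have "\<And>b. b \<in> B' \<Longrightarrow> T b \<subseteq> P - T b0" using less.prems(2) by (auto simp: B'_def)
    ultimately have "\<exists>C. C \<subseteq> B' \<and> finite C \<and> disjoint_family_on T C \<and>
           (\<forall>b\<in>B'. \<exists>c\<in>C. T b \<inter> T c \<noteq> {} \<and> rank b \<le> rank c)"
      using less.prems(1,3,4) by (intro less.hyps[of "P - T b0" B']) (auto simp: B'_def)
    then obtain C where C: "C \<subseteq> B'" "finite C" "disjoint_family_on T C"
         "\<forall>b\<in>B'. \<exists>c\<in>C. T b \<inter> T c \<noteq> {} \<and> rank b \<le> rank c"
      by (elim exE conjE) (rule that)
    show ?thesis
    proof (intro exI[of _ "insert b0 C"] conjI ballI)
      show "disjoint_family_on T (insert b0 C)"
        using C(1,3) by (auto simp: disjoint_family_on_def B'_def)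
      fix b assume b: "b \<in> B"
      show "\<exists>c\<in>insert b0 C. T b \<inter> T c \<noteq> {} \<and> rank b \<le> rank c"
        using b0(2)[OF b] bspec[OF C(4), of b] b by (cases "b \<in> B'") (auto simp: B'_def)
    qed (use C b0 in \<open>auto simp: B'_def\<close>)
  qed
qed

text \<open>The discrete counterpart, at scale \<open>\<delta>\<close>, of a Frostman measure of exponent \<open>t\<close> on \<open>F\<close>.\<close>

definition spread :: "'e set \<Rightarrow> ('e \<Rightarrow> 'e \<Rightarrow> real) \<Rightarrow> real \<Rightarrow> real \<Rightarrow> 'e set \<Rightarrow> bool" where
  "spread F d t \<delta> P \<longleftrightarrow> finite P \<and> P \<subseteq> F \<and>
     (\<forall>x\<in>F. \<forall>i::nat. real (card {y\<in>P. d x y \<le> 2 ^ i * \<delta>}) \<le> 2 powr (real i * t))"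

text \<open>This replaces Frostman's lemma for arbitrary, possibly non-measurable sets. In a spread set of
  maximal cardinality no point can be added, so every point of \<open>F\<close> lies in a ball where the counting
  bound is almost attained. Among these balls Vitali's selection leaves disjoint ones, whose total
  \<open>t\<close>-content is at most twice the cardinality, and tripling them covers \<open>F\<close>.\<close>

lemma cover_by_spread_bound:
  assumes d: "Metric_space F d" and \<delta>: "0 < \<delta>" and t: "0 < t"
    and bound: "\<And>P. spread F d t \<delta> P \<Longrightarrow> real (card P) \<le> K"
  shows "\<exists>C. finite C \<and> C \<subseteq> F \<times> UNIV \<and> F \<subseteq> (\<Union>(x, i)\<in>C. {y\<in>F. d x y \<le> 3 * (2 ^ i * \<delta>)}) \<and>
           (\<Sum>(x, i)\<in>C. 2 powr (real i * t)) \<le> 2 * K"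
proof -
  interpret Metric_space F d by (rule d)
  define tr where "tr P b = {y\<in>P. d (fst b) y \<le> 2 ^ snd b * \<delta>}" for P and b :: "'a \<times> nat"
  have "spread F d t \<delta> {}" by (simp add: spread_def)
  moreover have "\<forall>P. spread F d t \<delta> P \<longrightarrow> card P < nat \<lfloor>K\<rfloor> + 1"
    using bound by (metis le_nat_floor less_add_one le_imp_less_Suc Suc_eq_plus1)
  ultimately obtain P where P: "spread F d t \<delta> P"
    and max: "\<And>Q. spread F d t \<delta> Q \<Longrightarrow> card Q \<le> card P"
    using ex_has_greatest_nat[of "spread F d t \<delta>" "{}" card] by (metis less_imp_le)
  have fP: "finite P" and PF: "P \<subseteq> F" using P by (auto simp: spread_def)
  define B where "B = {b. fst b \<in> F \<and> tr P b \<noteq> {} \<and> 2 powr (real (snd b) * t) \<le> 2 * real (card (tr P b))}"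
  \<comment> \<open>Maximality puts every point in a saturated ball.\<close>
  have inB: "\<exists>b\<in>B. d (fst b) y \<le> 2 ^ snd b * \<delta>" if y: "y \<in> F" for y
  proof (cases "y \<in> P")
    case True
    then have "y \<in> tr P (y, 0)" using y \<delta> by (simp add: tr_def)
    moreover have "finite (tr P (y, 0))" using fP by (simp add: tr_def)
    ultimately have "card (tr P (y, 0)) \<ge> 1" "tr P (y, 0) \<noteq> {}"
      by (auto simp: Suc_le_eq card_gt_0_iff)
    then have "(y, 0) \<in> B" using y by (auto simp: B_def)
    then show ?thesis using y \<delta> by force
  next
    case False
    have "\<not> spread F d t \<delta> (insert y P)" using max[of "insert y P"] False fP by auto
    then obtain x i where xi: "x \<in> F"
      "\<not> real (card {z\<in>insert y P. d x z \<le> 2 ^ i * \<delta>}) \<le> 2 powr (real i * t)"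
      using fP PF y by (auto simp: spread_def)
    have old: "real (card (tr P (x, i))) \<le> 2 powr (real i * t)"
      using P xi(1) by (simp add: spread_def tr_def)
    have yx: "d x y \<le> 2 ^ i * \<delta>"
    proof (rule ccontr)
      assume "\<not> ?thesis"
      then have "{z\<in>insert y P. d x z \<le> 2 ^ i * \<delta>} = tr P (x, i)" by (auto simp: tr_def)
      then show False using old xi(2) by simp
    qed
    then have "{z\<in>insert y P. d x z \<le> 2 ^ i * \<delta>} = insert y (tr P (x, i))" by (auto simp: tr_def)
    moreover have "finite (tr P (x, i))" "y \<notin> tr P (x, i)" using fP False by (auto simp: tr_def)
    ultimately have c: "2 powr (real i * t) < real (card (tr P (x, i))) + 1" using xi(2) by simp
    have "1 \<le> 2 powr (real i * t)" using t by (intro ge_one_powr_ge_zero) auto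
    with c have "card (tr P (x, i)) \<ge> 1" by linarith
    then have "tr P (x, i) \<noteq> {}" "2 powr (real i * t) \<le> 2 * real (card (tr P (x, i)))"
      using c by auto
    then show ?thesis using xi(1) yx by (auto simp: B_def intro!: bexI[of _ "(x, i)"])
  qed
  \<comment> \<open>Saturated balls have bounded radius, because \<open>t > 0\<close> and \<open>P\<close> is finite.\<close>
  define L where "L = nat \<lceil>log 2 (2 * real (card P) + 1) / t\<rceil>"
  have rank: "snd b \<le> L" if "b \<in> B" for b
  proof -
    have "2 powr (real (snd b) * t) \<le> 2 * real (card (tr P b))" using that by (simp add: B_def)
    also have "\<dots> \<le> 2 * real (card P) + 1"
      using card_mono[OF fP, of "tr P b"] by (simp add: tr_def)
    finally have "real (snd b) * t \<le> log 2 (2 * real (card P) + 1)"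
      by (subst le_log_iff) auto
    then have "real (snd b) \<le> log 2 (2 * real (card P) + 1) / t" using t by (simp add: field_simps)
    then show ?thesis unfolding L_def by linarith
  qed
  have "\<exists>C. C \<subseteq> B \<and> finite C \<and> disjoint_family_on (tr P) C \<and>
           (\<forall>b\<in>B. \<exists>c\<in>C. tr P b \<inter> tr P c \<noteq> {} \<and> snd b \<le> snd c)"
  proof (rule vitali_selection[OF fP _ _ rank])
    show "\<And>b. b \<in> B \<Longrightarrow> tr P b \<subseteq> P" unfolding tr_def by blast
    show "\<And>b. b \<in> B \<Longrightarrow> tr P b \<noteq> {}" by (simp add: B_def)
  qed
  then obtain C where C: "C \<subseteq> B" "finite C" "disjoint_family_on (tr P) C"
    "\<forall>b\<in>B. \<exists>c\<in>C. tr P b \<inter> tr P c \<noteq> {} \<and> snd b \<le> snd c"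
    by (elim exE conjE) (rule that)
  have "y \<in> (\<Union>(x, i)\<in>C. {y\<in>F. d x y \<le> 3 * (2 ^ i * \<delta>)})" if y: "y \<in> F" for y
  proof -
    obtain b where b: "b \<in> B" "d (fst b) y \<le> 2 ^ snd b * \<delta>" using inB[OF y] by blast
    obtain c p where c: "c \<in> C" "p \<in> tr P b" "p \<in> tr P c" "snd b \<le> snd c" using bspec[OF C(4) b(1)] by blast
    have F: "fst b \<in> F" "fst c \<in> F" "p \<in> F" using b c C(1) PF by (auto simp: B_def tr_def)
    have le: "2 ^ snd b * \<delta> \<le> 2 ^ snd c * \<delta>" using c(4) \<delta> by (simp add: power_increasing)
    have "d (fst c) y \<le> d (fst c) p + d p (fst b) + d (fst b) y"
      using triangle[OF F(2) F(3) y] triangle[OF F(3) F(1) y] by linarith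
    then have "d (fst c) y \<le> 3 * (2 ^ snd c * \<delta>)"
      using le b(2) c(2,3) commute[of p "fst b"] by (simp add: tr_def)
    then show ?thesis using c(1) y by (auto intro!: bexI[of _ c])
  qed
  moreover have "(\<Sum>(x, i)\<in>C. 2 powr (real i * t)) \<le> 2 * K"
  proof -
    have "(\<Sum>(x, i)\<in>C. 2 powr (real i * t)) \<le> (\<Sum>b\<in>C. 2 * real (card (tr P b)))"
      using C(1) by (intro sum_mono) (auto simp: B_def)
    also have "\<dots> = 2 * real (\<Sum>b\<in>C. card (tr P b))" by (simp add: sum_distrib_left)
    also have "(\<Sum>b\<in>C. card (tr P b)) = card (\<Union>b\<in>C. tr P b)"
      using C fP by (intro card_UN_disjoint[symmetric]) (auto simp: disjoint_family_on_def tr_def)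
    also have "\<dots> \<le> card P" using fP by (intro card_mono) (auto simp: tr_def)
    finally show ?thesis using bound[OF P] by simp
  qed
  ultimately show ?thesis using C(1,2) by (intro exI[of _ C]) (auto simp: B_def)
qed

text \<open>This is the Cauchy--Schwarz inequality for the counting function of the sets and the indicator of
  \<open>H\<close>, in the linearised form \<open>2 f \<le> l + f\<^sup>2 / l\<close> that can be summed over many \<open>H\<close> with one \<open>l\<close>.\<close>

lemma measure_pair_correlation:
  fixes S :: "'p \<Rightarrow> 'x set"
  assumes fP: "finite P" and S: "\<And>p. p \<in> P \<Longrightarrow> S p \<in> sets M" "\<And>p. p \<in> P \<Longrightarrow> S p \<subseteq> H"
    and H: "H \<in> sets M" "emeasure M H < \<infinity>" and l: "0 < l"
  shows "2 * (\<Sum>p\<in>P. measure M (S p)) \<le>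
           l * measure M H + (\<Sum>p\<in>P. \<Sum>q\<in>P. measure M (S p \<inter> S q)) / l"
proof -
  have fin: "emeasure M A < \<infinity>" if "A \<in> sets M" "A \<subseteq> H" for A
    using emeasure_mono[OF that(2) H(1)] H(2) by (simp add: le_less_trans)
  have int: "integrable M (indicat_real A)" "(\<integral>x. indicat_real A x \<partial>M) = measure M A"
    if "A \<in> sets M" "A \<subseteq> H" for A
    using that fin[OF that] sets.sets_into_space[OF that(1)] by (auto simp: Int_absorb2)
  define f where "f x = (\<Sum>p\<in>P. indicat_real (S p) x)" for x
  have If: "integrable M f" "(\<integral>x. f x \<partial>M) = (\<Sum>p\<in>P. measure M (S p))"
    unfolding f_def using S by (auto simp: int)
  have sq: "f x * f x = (\<Sum>p\<in>P. \<Sum>q\<in>P. indicat_real (S p \<inter> S q) x)" for x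
    unfolding f_def by (simp add: sum_product indicator_inter_arith)
  have Ig: "integrable M (\<lambda>x. f x * f x)"
      "(\<integral>x. f x * f x \<partial>M) = (\<Sum>p\<in>P. \<Sum>q\<in>P. measure M (S p \<inter> S q))"
  proof -
    have I: "S p \<inter> S q \<in> sets M" "S p \<inter> S q \<subseteq> H" if "p \<in> P" "q \<in> P" for p q
      using that S by (auto intro: sets.Int)
    show "integrable M (\<lambda>x. f x * f x)"
      unfolding sq by (intro Bochner_Integration.integrable_sum int I)
    have "(\<integral>x. (\<Sum>p\<in>P. \<Sum>q\<in>P. indicat_real (S p \<inter> S q) x) \<partial>M) =
        (\<Sum>p\<in>P. \<integral>x. (\<Sum>q\<in>P. indicat_real (S p \<inter> S q) x) \<partial>M)"
      by (intro Bochner_Integration.integral_sum Bochner_Integration.integrable_sum int I)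
    also have "\<dots> = (\<Sum>p\<in>P. \<Sum>q\<in>P. \<integral>x. indicat_real (S p \<inter> S q) x \<partial>M)"
      by (intro sum.cong refl Bochner_Integration.integral_sum int I)
    also have "\<dots> = (\<Sum>p\<in>P. \<Sum>q\<in>P. measure M (S p \<inter> S q))"
      by (intro sum.cong refl int I)
    finally show "(\<integral>x. f x * f x \<partial>M) = (\<Sum>p\<in>P. \<Sum>q\<in>P. measure M (S p \<inter> S q))"
      unfolding sq .
  qed
  have "(\<integral>x. 2 * f x \<partial>M) \<le> (\<integral>x. l * indicat_real H x + (f x * f x) / l \<partial>M)"
  proof (rule integral_mono)
    fix x
    have "0 \<le> (f x - l)\<^sup>2 / l" using l by simp
    also have "(f x - l)\<^sup>2 / l = f x * f x / l - 2 * f x + l"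
      using l by (simp add: power2_eq_square field_simps)
    finally have "2 * f x \<le> l + f x * f x / l" by simp
    moreover have "f x = 0" if "x \<notin> H" unfolding f_def
    proof (intro sum.neutral ballI)
      fix p assume "p \<in> P"
      then show "indicat_real (S p) x = 0" using that S(2)[of p] by (auto simp: indicator_def)
    qed
    ultimately show "2 * f x \<le> l * indicat_real H x + (f x * f x) / l"
      by (cases "x \<in> H") auto
  qed (use If Ig int(1)[OF H(1)] in auto)
  also have "\<dots> = l * measure M H + (\<Sum>p\<in>P. \<Sum>q\<in>P. measure M (S p \<inter> S q)) / l"
    using Ig int[OF H(1)] by simp
  finally show ?thesis using If by simp
qed


section \<open>Sublevel sets of affine maps\<close>

text \<open>If the constant term dominates, the sublevel set is empty unless \<open>r\<close> is comparable to it.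
  Otherwise choose a unit vector \<open>v\<close> on which \<open>L\<close> almost attains its norm: moving the sublevel set
  along \<open>v\<close> by \<open>3 r / norm (L v)\<close> makes it disjoint from itself, and about \<open>norm (L v) / (3 r)\<close>
  such translates fit into a cube of side \<open>3\<close>.\<close>

lemma measure_affine_sublevel:
  fixes L :: "real ^ 'n \<Rightarrow> real ^ 'n" and b :: "real ^ 'n"
  assumes L: "linear L" and r: "0 < r"
  shows "(onorm L + norm b) * measure lborel {x \<in> cbox 0 1. norm (L x + b) \<le> r}
           \<le> 6 * (2 * real CARD('n) + 1) * 3 ^ CARD('n) * r"
proof -
  define n where "n = CARD('n)"
  define S where "S = {x \<in> cbox (0 :: real ^ 'n) 1. norm (L x + b) \<le> r}"
  define C where "C = 6 * (2 * real n + 1) * 3 ^ n"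
  have n: "1 \<le> real n" by (simp add: n_def Suc_le_eq)
  have bl: "bounded_linear L" using L by (simp add: linear_conv_bounded_linear)
  have cont: "continuous_on UNIV L" using bl by (rule linear_continuous_on)
  have "closed {x. norm (L x + b) \<le> r}"
    by (intro closed_Collect_le continuous_intros continuous_on_subset[OF cont]) auto
  then have cS: "compact S"
    unfolding S_def Collect_conj_eq by (intro compact_Int_closed) (auto simp: Int_def)
  have vol: "measure lborel (cbox (0 :: real ^ 'n) 1) = 1"
    by (subst content_cbox_cart) (auto simp: interval_ne_empty_cart)
  have S1: "measure lborel S \<le> 1"
  proof -
    have "measure lborel S \<le> measure lborel (cbox (0 :: real ^ 'n) 1)"
      using cS by (intro measure_mono_fmeasurable) (simp_all add: borel_compact, simp add: S_def)
    then show ?thesis by (simp add: vol)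
  qed
  have C4: "4 \<le> C"
  proof -
    have "1 * 1 \<le> (2 * real n + 1) * 3 ^ n" using n by (intro mult_mono) auto
    moreover have "C = 6 * ((2 * real n + 1) * 3 ^ n)" by (simp add: C_def)
    ultimately show ?thesis by linarith
  qed
  have o0: "0 \<le> onorm L" by (rule onorm_pos_le[OF bl])
  have "(onorm L + norm b) * measure lborel S \<le> C * r"
  proof (cases "2 * real n * onorm L \<le> norm b")
    case True
    show ?thesis
    proof (cases "S = {}")
      case False
      then obtain x where x: "x \<in> cbox 0 1" "norm (L x + b) \<le> r" by (auto simp: S_def)
      have "norm x \<le> (\<Sum>i\<in>UNIV. \<bar>x $ i\<bar>)" by (rule norm_le_l1_cart)
      also have "\<dots> \<le> (\<Sum>i\<in>(UNIV :: 'n set). 1)"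
        using x(1) by (intro sum_mono) (auto simp: mem_box_cart)
      also have "\<dots> = real n" by (simp add: n_def)
      finally have "onorm L * norm x \<le> onorm L * real n" using o0 by (rule mult_left_mono)
      then have "norm (L x) \<le> norm b / 2" using onorm[OF bl, of x] True by (simp add: mult_ac)
      then have b: "norm b \<le> 2 * r" using x(2) norm_diff_ineq[of b "L x"] by (simp add: add.commute)
      have "1 * onorm L \<le> 2 * real n * onorm L" using n o0 by (intro mult_right_mono) auto
      then have "onorm L + norm b \<le> 4 * r" using True b by simp
      then have "(onorm L + norm b) * measure lborel S \<le> (4 * r) * 1"
        using S1 r by (intro mult_mono) auto
      also have "\<dots> \<le> C * r" using C4 r by simp
      finally show ?thesis .
    qed (use C4 r in auto)
  next
    case False
    then have op: "0 < onorm L"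
      using o0 by (metis linorder_not_less mult_zero_right norm_ge_zero order_le_less)
    have "\<exists>x. onorm L / 2 * norm x < norm (L x)"
    proof (rule ccontr)
      assume "\<not> ?thesis"
      then have "onorm L \<le> onorm L / 2" by (intro onorm_le) (auto simp: not_less)
      then show False using op by simp
    qed
    then obtain x where x: "onorm L / 2 * norm x < norm (L x)" by blast
    then have x0: "x \<noteq> 0" using linear_0[OF L] by auto
    define v where "v = x /\<^sub>R norm x"
    define l where "l = norm (L v)"
    have v: "norm v = 1" using x0 by (simp add: v_def)
    have l: "onorm L \<le> 2 * l"
      using x x0 unfolding l_def v_def linear_scale[OF L] by (simp add: field_simps)
    then have l0: "0 < l" using op by simp
    define \<tau> where "\<tau> = 3 * r / l"
    have \<tau>0: "0 < \<tau>" using r l0 by (simp add: \<tau>_def)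
    define K where "K = nat \<lfloor>1 / \<tau>\<rfloor> + 1"
    define T where "T m = (+) ((real m * \<tau>) *\<^sub>R v) ` S" for m :: nat
    have K: "1 / \<tau> \<le> real K" unfolding K_def by linarith
    have m\<tau>: "real m * \<tau> \<le> 1" if "m < K" for m
    proof -
      have "real m \<le> 1 / \<tau>" using that \<tau>0 unfolding K_def by (simp add: less_Suc_eq_le le_nat_floor le_nat_iff le_floor_iff)
      then show ?thesis using \<tau>0 by (simp add: field_simps)
    qed
    have cT: "compact (T m)" for m unfolding T_def by (rule compact_translation[OF cS])
    have mT: "measure lborel (T m) = measure lborel S" for m
    proof -
      have "measure lebesgue (T m) = measure lebesgue S" unfolding T_def by (rule measure_translation)
      then show ?thesis using cT[of m] cS by (simp add: measure_completion borel_compact)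
    qed
    have disj: "disjoint_family_on T {..<K}"
      unfolding disjoint_family_on_def
    proof (intro ballI impI)
      fix m m' assume m: "m \<in> {..<K}" "m' \<in> {..<K}" "m \<noteq> m'"
      show "T m \<inter> T m' = {}"
      proof (rule ccontr)
        assume "T m \<inter> T m' \<noteq> {}"
        then obtain y z where yz: "y \<in> S" "z \<in> S" "(real m * \<tau>) *\<^sub>R v + y = (real m' * \<tau>) *\<^sub>R v + z"
          by (auto simp: T_def)
        then have "y - z = ((real m' - real m) * \<tau>) *\<^sub>R v" by (simp add: algebra_simps)
        then have "L y - L z = ((real m' - real m) * \<tau>) *\<^sub>R L v"
          using linear_diff[OF L] linear_scale[OF L] by metis
        then have "norm (L y - L z) = \<bar>real m' - real m\<bar> * (\<tau> * l)"
          using \<tau>0 by (simp add: l_def abs_mult)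
        also have "\<dots> \<ge> 1 * (\<tau> * l)"
          using m(3) \<tau>0 l0 by (intro mult_right_mono) auto
        also have "1 * (\<tau> * l) = 3 * r" using l0 by (simp add: \<tau>_def)
        finally have "3 * r \<le> norm (L y - L z)" .
        also have "L y - L z = (L y + b) - (L z + b)" by simp
        also have "norm \<dots> \<le> r + r"
          using yz by (intro norm_triangle_le_diff add_mono) (auto simp: S_def)
        finally show False using r by simp
      qed
    qed
    have sub: "T m \<subseteq> cbox (-1) 2" if "m < K" for m
    proof
      fix y assume "y \<in> T m"
      then obtain z where z: "z \<in> S" "y = (real m * \<tau>) *\<^sub>R v + z" by (auto simp: T_def)
      have "\<bar>real m * \<tau> * v $ i\<bar> \<le> 1" for i
      proof -
        have "\<bar>v $ i\<bar> \<le> 1" using component_le_norm_cart[of v i] v by simp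
        then have "\<bar>real m * \<tau>\<bar> * \<bar>v $ i\<bar> \<le> 1 * 1" using m\<tau>[OF that] \<tau>0 by (intro mult_mono) auto
        then show ?thesis by (simp add: abs_mult)
      qed
      then show "y \<in> cbox (-1) 2"
        using z by (auto simp: S_def mem_box_cart abs_le_iff) (smt (verit) zero_index one_index)+
    qed
    have "emeasure lborel (T m) \<noteq> \<infinity>" for m
      using emeasure_compact_finite[OF cT[of m]] by simp
    note fin = this
    have "real K * measure lborel S = (\<Sum>m<K. measure lborel (T m))" by (simp add: mT)
    also have "\<dots> = measure lborel (\<Union>m<K. T m)"
      using disj cT fin by (intro measure_finite_Union[symmetric])
        (auto simp: borel_compact)
    also have "\<dots> \<le> measure lborel (cbox (-1) (2 :: real ^ 'n))"
      using sub cT by (intro measure_mono_fmeasurable) (auto simp: borel_compact)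
    also have "\<dots> = 3 ^ n"
      by (subst content_cbox_cart) (auto simp: interval_ne_empty_cart n_def)
    finally have "1 / \<tau> * measure lborel S \<le> 3 ^ n"
      using mult_right_mono[OF K, of "measure lborel S"] by simp
    then have lS: "l * measure lborel S \<le> 3 * 3 ^ n * r" using l0 r by (simp add: \<tau>_def field_simps)
    have "onorm L + norm b \<le> (2 * real n + 1) * onorm L" using False by (simp add: algebra_simps)
    also have "\<dots> \<le> (2 * real n + 1) * (2 * l)" using l by (intro mult_left_mono) auto
    finally have "(onorm L + norm b) * measure lborel S \<le> (2 * real n + 1) * (2 * l) * measure lborel S"
      by (intro mult_right_mono) auto
    also have "\<dots> = (2 * real n + 1) * 2 * (l * measure lborel S)" by simp
    also have "\<dots> \<le> (2 * real n + 1) * 2 * (3 * 3 ^ n * r)" using lS by (intro mult_left_mono) auto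
    also have "\<dots> = C * r" by (simp add: C_def)
    finally show ?thesis .
  qed
  then show ?thesis by (simp add: S_def C_def n_def)
qed


section \<open>Families of graphs with transversality\<close>

lemma measure_unit_cube: "measure lborel (cbox (0 :: real ^ 'n) 1) = 1"
  by (subst content_cbox_cart) (auto simp: interval_ne_empty_cart)

text \<open>The part of the unit cube whose \<open>I\<close>-coordinates are within \<open>r\<close> of those of \<open>z\<close>.\<close>

definition shadow_box :: "'n set \<Rightarrow> real ^ 'n \<Rightarrow> real \<Rightarrow> (real ^ 'n) set" where
  "shadow_box I z r = cbox (\<chi> j. if j \<in> I then z $ j - r else 0) (\<chi> j. if j \<in> I then z $ j + r else 1)"

lemma measure_shadow_box:
  fixes z :: "real ^ 'n"
  assumes r: "0 < r"
  shows "measure lborel (shadow_box I z r) = (2 * r) ^ card I"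
proof -
  define a where "a = (\<chi> j. if j \<in> I then z $ j - r else 0)"
  define b where "b = (\<chi> j. if j \<in> I then z $ j + r else 1)"
  have "measure lborel (cbox a b) = (\<Prod>j\<in>UNIV. b $ j - a $ j)"
    using r by (intro content_cbox_cart) (auto simp: interval_ne_empty_cart a_def b_def)
  also have "\<dots> = (\<Prod>j\<in>UNIV. if j \<in> I then 2 * r else 1)"
    by (intro prod.cong) (auto simp: a_def b_def)
  also have "\<dots> = (2 * r) ^ card I" by (simp add: prod.If_cases)
  finally show ?thesis by (simp add: shadow_box_def a_def b_def)
qed

text \<open>Each \<open>e\<close> of the parameter set carries a graph \<open>x \<mapsto> \<phi> e x\<close> over the coordinates in \<open>I\<close>, and the
  set of \<open>x\<close> where two graphs are \<open>r\<close>-close has measure at most of order \<open>r / d e e'\<close>. The linear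
  dependence on \<open>r\<close> is what restricts the results to exponents \<open>t < 1\<close>.\<close>

locale transversal_family = Metric_space F d
  for F :: "'e set" and d :: "'e \<Rightarrow> 'e \<Rightarrow> real" +
  fixes \<phi> :: "'e \<Rightarrow> real ^ 'n \<Rightarrow> real ^ 'n" and I :: "'n set" and c :: real
  assumes continuous_point: "e \<in> F \<Longrightarrow> continuous_on UNIV (\<phi> e)"
    and point_coord: "e \<in> F \<Longrightarrow> i \<in> I \<Longrightarrow> \<phi> e x $ i = x $ i"
    and transversal: "e \<in> F \<Longrightarrow> e' \<in> F \<Longrightarrow> 0 < r \<Longrightarrow>
          d e e' * measure lborel {x \<in> cbox 0 1. norm (\<phi> e x - \<phi> e' x) \<le> r} \<le> c * r"
    and c_nonneg: "0 \<le> c"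
begin

definition near :: "'e \<Rightarrow> 'e \<Rightarrow> real \<Rightarrow> (real ^ 'n) set" where
  "near e e' r = {x \<in> cbox 0 1. norm (\<phi> e x - \<phi> e' x) \<le> r}"

definition hits :: "'e \<Rightarrow> (real ^ 'n) set \<Rightarrow> (real ^ 'n) set" where
  "hits e D = {x \<in> cbox 0 1. \<phi> e x \<in> D}"

lemma near_borel: "e \<in> F \<Longrightarrow> e' \<in> F \<Longrightarrow> near e e' r \<in> sets borel"
proof -
  assume e: "e \<in> F" "e' \<in> F"
  have "closed {x. norm (\<phi> e x - \<phi> e' x) \<le> r}"
    by (intro closed_Collect_le continuous_intros continuous_point e)
  then have "closed (cbox 0 1 \<inter> {x. norm (\<phi> e x - \<phi> e' x) \<le> r})" by (intro closed_Int) auto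
  then show ?thesis by (auto simp: near_def Int_def)
qed

lemma hits_borel: "e \<in> F \<Longrightarrow> D \<in> sets borel \<Longrightarrow> hits e D \<in> sets borel"
proof -
  assume e: "e \<in> F" and D: "D \<in> sets borel"
  have "\<phi> e \<in> borel_measurable borel"
    using continuous_point[OF e] by (rule borel_measurable_continuous_onI)
  then have "\<phi> e -` D \<inter> space borel \<in> sets borel" using D by (rule measurable_sets)
  then have "cbox 0 1 \<inter> \<phi> e -` D \<in> sets borel" by simp
  then show ?thesis by (auto simp: hits_def Int_def vimage_def)
qed

text \<open>The shadow does not depend on \<open>e\<close>, since every graph preserves the \<open>I\<close>-coordinates.\<close>

lemma hits_subset_shadow_box:
  assumes e: "e \<in> F" and D: "D \<subseteq> cball z r"
  shows "hits e D \<subseteq> shadow_box I z r"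
proof
  fix x assume x: "x \<in> hits e D"
  have "norm (\<phi> e x - z) \<le> r" using x D by (auto simp: hits_def dist_norm norm_minus_commute)
  then have "\<bar>\<phi> e x $ j - z $ j\<bar> \<le> r" for j
    using component_le_norm_cart[of "\<phi> e x - z" j] by simp
  then have *: "\<bar>x $ j - z $ j\<bar> \<le> r" if "j \<in> I" for j using point_coord[OF e that, of x] by metis
  have "z $ j - r \<le> x $ j" "x $ j \<le> z $ j + r" if "j \<in> I" for j
    using *[OF that] by auto
  then show "x \<in> shadow_box I z r" using x by (auto simp: mem_box_cart shadow_box_def hits_def)
qed

text \<open>The pairs at distance about \<open>2\<^sup>i \<delta>\<close> number at most \<open>2\<^sup>i\<^sup>t\<close> and contribute about \<open>2\<^sup>-\<^sup>i\<close> each; the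
  resulting series is geometric with ratio \<open>2\<^sup>t\<^sup>-\<^sup>1 < 1\<close>.\<close>

lemma correlation_bound:
  assumes P: "finite P" "P \<subseteq> F" and e: "e \<in> F" and \<delta>: "0 < \<delta>" and t: "t < 1"
    and sep: "\<And>i::nat. real (card {e'\<in>P. d e e' \<le> 2 ^ i * \<delta>}) \<le> 2 powr (real i * t)"
  shows "(\<Sum>e'\<in>P. measure lborel (near e e' (2 * \<delta>))) \<le> (4 * c + 1) / (1 - 2 powr (t - 1))"
proof -
  define g where "g e' i = (if d e e' \<le> 2 ^ i * \<delta> then (1/2) ^ i else 0 :: real)" for e' and i :: nat
  have g0: "0 \<le> g e' i" for e' i by (simp add: g_def)
  have sg: "summable (g e')" for e'
    by (rule summable_comparison_test[OF _ summable_geometric[of "1/2 :: real"]]) (auto simp: g_def)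
  have single: "measure lborel (near e e' (2 * \<delta>)) \<le> (4 * c + 1) * (\<Sum>i. g e' i)" if e': "e' \<in> P" for e'
  proof -
    have e'F: "e' \<in> F" using e' P by auto
    define \<mu> where "\<mu> = measure lborel (near e e' (2 * \<delta>))"
    have \<mu>1: "\<mu> \<le> 1"
    proof -
      have "\<mu> \<le> measure lborel (cbox (0 :: real ^ 'n) 1)"
        unfolding \<mu>_def using near_borel[OF e e'F]
        by (intro measure_mono_fmeasurable) (auto simp: near_def)
      then show ?thesis by (simp add: measure_unit_cube)
    qed
    have \<mu>0: "0 \<le> \<mu>" by (simp add: \<mu>_def)
    obtain m where "d e e' / \<delta> < 2 ^ m" using real_arch_pow[of 2 "d e e' / \<delta>"] by auto
    then have m: "d e e' \<le> 2 ^ m * \<delta>" using \<delta> by (simp add: field_simps)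
    \<comment> \<open>One term of the series suffices, the one at the dyadic scale of the distance; at \<open>i = 0\<close> the
      trivial bound by the measure of the cube is used.\<close>
    define i where "i = (LEAST i. d e e' \<le> 2 ^ i * \<delta>)"
    have i: "d e e' \<le> 2 ^ i * \<delta>" unfolding i_def by (rule LeastI[of _ m]) (rule m)
    have "\<mu> \<le> (4 * c + 1) * (1/2) ^ i"
    proof (cases i)
      case 0
      have "1 * 1 \<le> (4 * c + 1) * (1 :: real)" using c_nonneg by (intro mult_right_mono) auto
      then show ?thesis using \<mu>1 0 by simp
    next
      case (Suc j)
      then have "\<not> d e e' \<le> 2 ^ j * \<delta>" unfolding i_def using not_less_Least[of j] by (metis lessI)
      then have "2 ^ j * \<delta> * \<mu> \<le> d e e' * \<mu>" using \<mu>0 by (intro mult_right_mono) auto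
      also have "\<dots> \<le> c * (2 * \<delta>)" unfolding \<mu>_def near_def using e e'F \<delta> by (intro transversal) auto
      finally have "\<delta> * (2 ^ j * \<mu>) \<le> \<delta> * (2 * c)" by (simp add: mult_ac)
      then have "2 ^ j * \<mu> \<le> 2 * c" using \<delta> by simp
      then have "\<mu> \<le> 4 * c * (1/2) ^ i" by (simp add: Suc power_one_over field_simps)
      then show ?thesis by (simp add: algebra_simps add_increasing)
    qed
    also have "(1/2) ^ i = g e' i" using i by (simp add: g_def)
    also have "g e' i = (\<Sum>j\<in>{i}. g e' j)" by simp
    also have "\<dots> \<le> (\<Sum>i. g e' i)" using g0 by (intro sum_le_suminf sg) auto
    finally show ?thesis using c_nonneg by (simp add: \<mu>_def mult_left_mono)
  qed
  define q where "q = (2 :: real) powr (t - 1)"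
  have q: "0 < q" "q < 1" using t by (auto simp: q_def powr_less_one)
  have row: "(\<Sum>e'\<in>P. g e' i) \<le> q ^ i" for i
  proof -
    have "(\<Sum>e'\<in>P. g e' i) = real (card {e'\<in>P. d e e' \<le> 2 ^ i * \<delta>}) * (1/2) ^ i"
      using P(1) by (simp add: g_def sum.If_cases Int_def)
    also have "\<dots> \<le> 2 powr (real i * t) * (1/2) ^ i" by (intro mult_right_mono sep) auto
    also have "(1/2 :: real) ^ i = 2 powr (- real i)" by (simp add: powr_minus powr_realpow power_one_over inverse_eq_divide)
    also have "2 powr (real i * t) * 2 powr (- real i) = (q powr real i)"
      by (simp add: q_def powr_powr powr_add[symmetric] algebra_simps)
    also have "\<dots> = q ^ i" using q by (simp add: powr_realpow)
    finally show ?thesis .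
  qed
  have "(\<Sum>e'\<in>P. measure lborel (near e e' (2 * \<delta>))) \<le> (\<Sum>e'\<in>P. (4 * c + 1) * (\<Sum>i. g e' i))"
    by (intro sum_mono single)
  also have "\<dots> = (4 * c + 1) * (\<Sum>i. \<Sum>e'\<in>P. g e' i)"
    by (simp add: sum_distrib_left[symmetric] suminf_sum[OF sg])
  also have "(\<Sum>i. \<Sum>e'\<in>P. g e' i) \<le> (\<Sum>i. q ^ i)"
    using q by (intro suminf_le row summable_sum sg summable_geometric) auto
  also have "\<dots> = 1 / (1 - q)" using q by (intro suminf_geometric) auto
  finally show ?thesis using c_nonneg by (simp add: q_def mult_left_mono)
qed

text \<open>A second moment argument in the style of Cordoba: every graph in \<open>P\<close> spends measure \<open>w\<close> in the
  \<open>card K\<close> sets \<open>D i\<close>, each of which casts a shadow of measure \<open>(2 \<delta>)\<close> to the power \<open>card I\<close>, while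
  two graphs that meet in the same \<open>D i\<close> over \<open>x\<close> are \<open>2 \<delta>\<close>-close there. Hence few sets can serve
  only few graphs.\<close>

lemma single_scale_bound:
  fixes D :: "nat \<Rightarrow> (real ^ 'n) set"
  assumes K: "finite K" and D: "\<And>i. i \<in> K \<Longrightarrow> D i \<in> sets borel" "\<And>i. i \<in> K \<Longrightarrow> D i \<subseteq> cball (z i) \<delta>"
      "disjoint_family_on D K"
    and P: "finite P" "P \<subseteq> F" and \<delta>: "0 < \<delta>" and w: "0 < w" and B: "0 < B"
    and corr: "\<And>e. e \<in> P \<Longrightarrow> (\<Sum>e'\<in>P. measure lborel (near e e' (2 * \<delta>))) \<le> B"
    and heavy: "\<And>e. e \<in> P \<Longrightarrow> w \<le> (\<Sum>i\<in>K. measure lborel (hits e (D i)))"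
  shows "real (card P) * w\<^sup>2 \<le> B * real (card K) * (2 * \<delta>) ^ card I"
proof -
  \<comment> \<open>The choice of \<open>l\<close> for which the correlation term absorbs half of the left-hand side.\<close>
  define l where "l = B / w"
  have l: "0 < l" using B w by (simp add: l_def)
  define S where "S e i = hits e (D i)" for e i
  have Sb: "S e i \<in> sets lborel" if "e \<in> P" "i \<in> K" for e i
    using that P D hits_borel by (auto simp: S_def)
  have per_i: "2 * (\<Sum>e\<in>P. measure lborel (S e i)) \<le>
      l * (2 * \<delta>) ^ card I + (\<Sum>e\<in>P. \<Sum>e'\<in>P. measure lborel (S e i \<inter> S e' i)) / l" if i: "i \<in> K" for i
  proof (cases "P = {}")
    case True
    then show ?thesis using l \<delta> by simp
  next
    case False
    define H where "H = shadow_box I (z i) \<delta>"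
    have Hm: "measure lborel H = (2 * \<delta>) ^ card I"
      unfolding H_def using \<delta> by (rule measure_shadow_box)
    have "2 * (\<Sum>e\<in>P. measure lborel (S e i)) \<le>
      l * measure lborel H + (\<Sum>e\<in>P. \<Sum>e'\<in>P. measure lborel (S e i \<inter> S e' i)) / l"
    proof (rule measure_pair_correlation[OF P(1)])
      show "S e i \<subseteq> H" if "e \<in> P" for e
        unfolding S_def H_def using that P(2) D(2)[OF i] by (intro hits_subset_shadow_box) auto
      show "emeasure lborel H < \<infinity>" unfolding H_def shadow_box_def by (rule emeasure_lborel_cbox_finite)
    qed (use Sb i l in \<open>auto simp: H_def shadow_box_def\<close>)
    then show ?thesis by (simp add: Hm)
  qed
  have pair: "(\<Sum>i\<in>K. measure lborel (S e i \<inter> S e' i)) \<le> measure lborel (near e e' (2 * \<delta>))"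
    if e: "e \<in> P" "e' \<in> P" for e e'
  proof -
    have Sbb: "S e i \<inter> S e' i \<in> sets lborel" if "i \<in> K" for i using that Sb e by (intro sets.Int) auto
    have cube: "near e e' (2 * \<delta>) \<in> fmeasurable lborel"
    proof (rule fmeasurableI2[OF fmeasurable_cbox[of 0 1]])
      show "near e e' (2 * \<delta>) \<in> sets lborel" using near_borel[of e e'] e P by auto
    qed (simp add: near_def)
    have sub: "S e i \<inter> S e' i \<subseteq> near e e' (2 * \<delta>)" if i: "i \<in> K" for i
    proof
      fix x assume x: "x \<in> S e i \<inter> S e' i"
      then have "dist (z i) (\<phi> e x) \<le> \<delta>" "dist (z i) (\<phi> e' x) \<le> \<delta>" "x \<in> cbox 0 1"
        using D(2)[OF i] by (auto simp: S_def hits_def)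
      then show "x \<in> near e e' (2 * \<delta>)"
        using dist_triangle[of "\<phi> e x" "\<phi> e' x" "z i"] by (simp add: near_def dist_norm[symmetric] dist_commute)
    qed
    have "(\<Sum>i\<in>K. measure lborel (S e i \<inter> S e' i)) = measure lborel (\<Union>i\<in>K. S e i \<inter> S e' i)"
    proof (rule measure_finite_Union[symmetric, OF K])
      show "disjoint_family_on (\<lambda>i. S e i \<inter> S e' i) K"
        using D(3) unfolding disjoint_family_on_def S_def hits_def by blast
      show "emeasure lborel (S e i \<inter> S e' i) \<noteq> \<infinity>" if "i \<in> K" for i
        using fmeasurableD2[OF fmeasurableI2[OF cube sub Sbb]] that by auto
    qed (use Sbb in auto)
    also have "\<dots> \<le> measure lborel (near e e' (2 * \<delta>))"
      using sub Sbb K cube by (intro measure_mono_fmeasurable) auto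
    finally show ?thesis .
  qed
  have "2 * (real (card P) * w) \<le> 2 * (\<Sum>e\<in>P. \<Sum>i\<in>K. measure lborel (S e i))"
    using sum_mono[OF heavy, of P] by (simp add: S_def)
  also have "\<dots> = (\<Sum>i\<in>K. 2 * (\<Sum>e\<in>P. measure lborel (S e i)))"
    by (subst sum.swap) (simp add: sum_distrib_left)
  also have "\<dots> \<le> (\<Sum>i\<in>K. l * (2 * \<delta>) ^ card I + (\<Sum>e\<in>P. \<Sum>e'\<in>P. measure lborel (S e i \<inter> S e' i)) / l)"
    by (intro sum_mono per_i)
  also have "\<dots> = l * real (card K) * (2 * \<delta>) ^ card I +
      (\<Sum>i\<in>K. \<Sum>e\<in>P. \<Sum>e'\<in>P. measure lborel (S e i \<inter> S e' i)) / l"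
    by (simp add: sum.distrib sum_divide_distrib)
  also have "(\<Sum>i\<in>K. \<Sum>e\<in>P. \<Sum>e'\<in>P. measure lborel (S e i \<inter> S e' i)) =
      (\<Sum>e\<in>P. \<Sum>e'\<in>P. \<Sum>i\<in>K. measure lborel (S e i \<inter> S e' i))"
    by (subst sum.swap) (intro sum.cong refl sum.swap)
  also have "\<dots> \<le> (\<Sum>e\<in>P. \<Sum>e'\<in>P. measure lborel (near e e' (2 * \<delta>)))"
    by (intro sum_mono pair)
  also have "\<dots> \<le> (\<Sum>e\<in>P. B)" by (intro sum_mono corr)
  also have "\<dots> = real (card P) * B" by simp
  finally have "2 * (real (card P) * w) \<le> l * real (card K) * (2 * \<delta>) ^ card I + real (card P) * B / l"
    using l by (simp add: divide_right_mono)
  also have "real (card P) * B / l = real (card P) * w" using B by (simp add: l_def)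
  finally have "real (card P) * w \<le> l * real (card K) * (2 * \<delta>) ^ card I" by linarith
  then have "real (card P) * w * w \<le> l * real (card K) * (2 * \<delta>) ^ card I * w"
    using w by (intro mult_right_mono) auto
  also have "\<dots> = B * real (card K) * (2 * \<delta>) ^ card I" using w by (simp add: l_def)
  finally show ?thesis by (simp add: power2_eq_square mult_ac)
qed

end

lemma exists_dyadic:
  assumes "0 < r" "r \<le> (1 :: real)"
  shows "\<exists>j. r \<le> (1/2) ^ j \<and> (1/2) ^ j \<le> 2 * r"
proof -
  define i where "i = (LEAST i. (1/2 :: real) ^ i < r)"
  obtain m where "(1/2 :: real) ^ m < r" using real_arch_pow_inv[of r "1/2"] assms by auto
  then have i: "(1/2) ^ i < r" unfolding i_def by (rule LeastI)
  then obtain j where j: "i = Suc j" using assms by (cases i) auto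
  then have "\<not> (1/2) ^ j < r" unfolding i_def using not_less_Least[of j] by (metis lessI)
  with i j show ?thesis by (intro exI[of _ j]) auto
qed

context transversal_family begin

lemma hits_sums:
  fixes D :: "nat \<Rightarrow> (real ^ 'n) set"
  assumes e: "e \<in> F" and D: "\<And>i. D i \<in> sets borel" "disjoint_family D"
    and cov: "\<And>x. x \<in> cbox 0 1 \<Longrightarrow> \<phi> e x \<in> (\<Union>i. D i)"
  shows "(\<lambda>i. measure lborel (hits e (D i))) sums 1"
proof -
  have eq: "(\<Union>i. hits e (D i)) = cbox 0 1" using cov by (auto simp: hits_def)
  have "(\<lambda>i. measure lborel (hits e (D i))) sums measure lborel (\<Union>i. hits e (D i))"
  proof (rule measure_UNION)
    show "range (\<lambda>i. hits e (D i)) \<subseteq> sets lborel" using hits_borel[OF e D(1)] by auto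
    show "disjoint_family (\<lambda>i. hits e (D i))"
      using D(2) unfolding disjoint_family_on_def hits_def by blast
    show "emeasure lborel (\<Union>i. hits e (D i)) \<noteq> \<infinity>"
      unfolding eq using emeasure_lborel_cbox_finite[of "0 :: real ^ 'n" 1] by (metis less_irrefl)
  qed
  then show ?thesis by (simp add: eq measure_unit_cube)
qed

text \<open>A cheap cover of the union yields a cheap cover of the parameter set. Replace the cover by balls
  of dyadic radius \<open>s j = 2\<^sup>-\<^sup>j\<close>, made disjoint. For each \<open>e\<close> some scale \<open>j\<close> carries a share of at
  least \<open>w j\<close> of its graph; the parameters served by scale \<open>j\<close> have spread subsets of cardinality
  at most of order \<open>N j * s j\<^sup>k / (w j)\<^sup>2\<close>, with \<open>N j\<close> the number of balls of that scale, so they can be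
  covered with \<open>t\<close>-content of order \<open>N j * s j\<^sup>t\<^sup>+\<^sup>k / (w j)\<^sup>2\<close>. The weights decay so slowly that this is
  of order \<open>N j * s j\<^sup>u\<close>, which sums to a small total.\<close>

theorem null_at_of_null_union:
  assumes t: "0 < t" "t < 1" and u: "0 < u" "u < t + real (card I)"
    and X: "\<And>e x. e \<in> F \<Longrightarrow> x \<in> cbox 0 1 \<Longrightarrow> \<phi> e x \<in> X"
    and N: "null_at UNIV dist u X"
  shows "null_at F d t F"
proof (rule null_atI[OF t(1)])
  fix \<epsilon> :: real assume \<epsilon>: "0 < \<epsilon>"
  define k where "k = card I"
  define B where "B = (4 * c + 1) / (1 - 2 powr (t - 1))"
  have "2 powr (t - 1) < 1" using t by (simp add: powr_less_one)
  then have B: "0 < B" using c_nonneg by (simp add: B_def)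
  \<comment> \<open>The loss \<open>1 / (w j)\<^sup>2\<close> then equals \<open>s j\<close> to the power \<open>u - (t + k)\<close>, up to a constant, and the
    total weight \<open>1/2\<close> is less than the measure of the unit cube.\<close>
  define q where "q = 2 powr (- (t + real k - u) / 2)"
  have q: "0 < q" "q < 1" using u by (auto simp: q_def k_def powr_less_one)
  define w where "w j = (1 - q) * q ^ j / 2" for j :: nat
  have w: "0 < w j" for j using q by (simp add: w_def)
  have w_sums: "w sums (1/2)"
    using sums_mult[OF geometric_sums[of q], of "(1 - q) / 2"] q by (simp add: w_def[abs_def] mult_ac)
  define C0 where "C0 = 6 powr t * 2 * B * 2 ^ k * 4 / (1 - q)\<^sup>2"
  have C0: "0 < C0" using B q by (simp add: C0_def)
  define \<epsilon>' where "\<epsilon>' = min 1 (\<epsilon> / (C0 * 2 powr u))"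
  have \<epsilon>': "0 < \<epsilon>'" using \<epsilon> C0 by (simp add: \<epsilon>'_def)
  obtain U :: "nat \<Rightarrow> (real ^ 'n) set" and r where U: "\<And>i. 0 < r i"
       "\<And>i x y. x \<in> U i \<Longrightarrow> y \<in> U i \<Longrightarrow> dist x y \<le> r i" "X \<subseteq> (\<Union>i. U i)"
       and rs: "\<And>F. finite F \<Longrightarrow> (\<Sum>i\<in>F. r i powr u) \<le> \<epsilon>'"
    by (rule null_atE[OF N \<epsilon>']) (rule that)
  have r1: "r i \<le> 1" for i
  proof (rule ccontr)
    assume "\<not> r i \<le> 1"
    then have "1 < r i powr u" using u by (simp add: gr_one_powr)
    then show False using rs[of "{i}"] by (simp add: \<epsilon>'_def)
  qed
  define s where "s j = (1/2 :: real) ^ j" for j :: nat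
  have s0: "0 < s j" for j by (simp add: s_def)
  have "\<exists>j. r i \<le> s j \<and> s j \<le> 2 * r i" for i
    unfolding s_def by (rule exists_dyadic[OF U(1) r1])
  then obtain lev where lev: "\<And>i. r i \<le> s (lev i)" "\<And>i. s (lev i) \<le> 2 * r i" by metis
  have ssum: "(\<Sum>i\<in>G. s (lev i) powr u) \<le> 2 powr u * \<epsilon>'" if G: "finite G" for G
  proof -
    have "s (lev i) powr u \<le> 2 powr u * r i powr u" for i
    proof -
      have "s (lev i) powr u \<le> (2 * r i) powr u"
        using lev(2)[of i] s0[of "lev i"] u by (intro powr_mono2) auto
      then show ?thesis using U(1)[of i] by (simp add: powr_mult)
    qed
    then have "(\<Sum>i\<in>G. s (lev i) powr u) \<le> 2 powr u * (\<Sum>i\<in>G. r i powr u)"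
      unfolding sum_distrib_left by (intro sum_mono)
    also have "\<dots> \<le> 2 powr u * \<epsilon>'" using rs[OF G] by (intro mult_left_mono) auto
    finally show ?thesis .
  qed
  \<comment> \<open>Each scale carries finitely many balls, since they all cost the same.\<close>
  define K where "K j = {i. lev i = j}" for j
  have fK: "finite (K j)" for j
  proof (rule finite_if_finite_subsets_card_bdd[THEN conjunct1])
    fix G assume G: "G \<subseteq> K j" "finite G"
    have "real (card G) * s j powr u = (\<Sum>i\<in>G. s (lev i) powr u)"
      using G(1) by (simp add: K_def subset_iff)
    also have "\<dots> \<le> 2 powr u * \<epsilon>'" by (rule ssum[OF G(2)])
    finally have "real (card G) \<le> 2 powr u * \<epsilon>' / s j powr u" using s0[of j] by (simp add: field_simps)
    then show "card G \<le> nat \<lfloor>2 powr u * \<epsilon>' / s j powr u\<rfloor>" by (rule le_nat_floor)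
  qed
  define z where "z i = (SOME z. z \<in> U i)" for i
  define A where "A i = cball (z i) (s (lev i))" for i
  have UA: "U i \<subseteq> A i" for i
  proof
    fix x assume x: "x \<in> U i"
    then have "z i \<in> U i" unfolding z_def by (rule someI)
    then have "dist (z i) x \<le> r i" using x by (rule U(2))
    then show "x \<in> A i" using lev(1)[of i] by (simp add: A_def)
  qed
  define D where "D = disjointed A"
  have DA: "D i \<subseteq> A i" for i by (simp add: D_def disjointed_subset)
  have Db: "D i \<in> sets borel" for i
  proof -
    have "range A \<subseteq> sets borel" by (auto simp: A_def)
    then have "range D \<subseteq> sets borel" unfolding D_def by (rule sets.range_disjointed_sets)
    then show ?thesis by auto
  qed
  have Dd: "disjoint_family D" unfolding D_def by (rule disjoint_family_disjointed)
  have DX: "X \<subseteq> (\<Union>i. D i)"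
    unfolding D_def UN_disjointed_eq using U(3) UN_mono[OF subset_refl UA] by (rule subset_trans)
  define F' where "F' j = {e\<in>F. w j \<le> (\<Sum>i\<in>K j. measure lborel (hits e (D i)))}" for j
  have cover: "\<exists>j. e \<in> F' j" if e: "e \<in> F" for e
  proof (rule ccontr)
    assume "\<not> ?thesis"
    then have "e \<notin> F' j" for j by blast
    then have small: "(\<Sum>i\<in>K j. measure lborel (hits e (D i))) \<le> w j" for j
      using e by (simp add: F'_def not_le less_imp_le)
    have S: "(\<lambda>i. measure lborel (hits e (D i))) sums 1"
      using X[OF e] DX by (intro hits_sums e Db Dd) auto
    have "(\<Sum>i. measure lborel (hits e (D i))) \<le> 1/2"
    proof (rule suminf_le_const[OF sums_summable[OF S]])
      fix n
      have "(\<Sum>i<n. measure lborel (hits e (D i)))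
          = (\<Sum>j\<in>lev ` {..<n}. \<Sum>i\<in>{i\<in>{..<n}. lev i = j}. measure lborel (hits e (D i)))"
        by (rule sum.image_gen) simp
      also have "\<dots> \<le> (\<Sum>j\<in>lev ` {..<n}. \<Sum>i\<in>K j. measure lborel (hits e (D i)))"
        by (intro sum_mono sum_mono2 fK) (auto simp: K_def)
      also have "\<dots> \<le> (\<Sum>j\<in>lev ` {..<n}. w j)" by (intro sum_mono small)
      also have "\<dots> \<le> (\<Sum>j. w j)"
        using w by (intro sum_le_suminf sums_summable[OF w_sums]) (auto simp: less_imp_le)
      also have "\<dots> = 1/2" using w_sums by (rule sums_unique[symmetric])
      finally show "(\<Sum>i<n. measure lborel (hits e (D i))) \<le> 1/2" .
    qed
    then show False using sums_unique[OF S] by simp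
  qed
  have MF: "Metric_space (F' j) d" for j
    by (rule subspace) (auto simp: F'_def)
  define N where "N j = real (card (K j))" for j
  define good where "good j C \<longleftrightarrow> finite C \<and> C \<subseteq> F' j \<times> UNIV \<and>
      F' j \<subseteq> (\<Union>(x, i)\<in>C. {y\<in>F' j. d x y \<le> 3 * (2 ^ i * s j)}) \<and>
      (\<Sum>(x, i)\<in>C. 2 powr (real i * t)) \<le> 2 * (B * N j * (2 * s j) ^ k / (w j)\<^sup>2)" for j and C :: "('e \<times> nat) set"
  have "\<exists>C. good j C" for j
    unfolding good_def
  proof (rule cover_by_spread_bound[OF MF s0 t(1)])
    fix P assume sp: "spread (F' j) d t (s j) P"
    then have P: "finite P" "P \<subseteq> F' j" by (auto simp: spread_def)
    then have PF: "P \<subseteq> F" by (auto simp: F'_def)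
    have "real (card P) * (w j)\<^sup>2 \<le> B * real (card (K j)) * (2 * s j) ^ card I"
    proof (rule single_scale_bound[OF fK _ _ _ P(1) PF s0 w B])
      show "D i \<subseteq> cball (z i) (s j)" if "i \<in> K j" for i
        using that DA[of i] by (simp add: K_def A_def)
      show "disjoint_family_on D (K j)" using Dd by (rule disjoint_family_on_mono[OF subset_UNIV])
      show "(\<Sum>e'\<in>P. measure lborel (near e e' (2 * s j))) \<le> B" if "e \<in> P" for e
        unfolding B_def using that sp PF by (intro correlation_bound P(1) s0 t) (auto simp: spread_def)
      show "w j \<le> (\<Sum>i\<in>K j. measure lborel (hits e (D i)))" if "e \<in> P" for e
        using that P(2) by (auto simp: F'_def)
    qed (rule Db)
    then show "real (card P) \<le> B * N j * (2 * s j) ^ k / (w j)\<^sup>2"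
      using w[of j] by (simp add: N_def k_def field_simps)
  qed
  then obtain C where C: "\<And>j. good j (C j)" by metis
  have fC: "\<And>j. finite (C j)" and CF: "\<And>j. C j \<subseteq> F' j \<times> UNIV"
     and Ccov: "\<And>j. F' j \<subseteq> (\<Union>(x, i)\<in>C j. {y\<in>F' j. d x y \<le> 3 * (2 ^ i * s j)})"
     and Csum: "\<And>j. (\<Sum>(x, i)\<in>C j. 2 powr (real i * t)) \<le> 2 * (B * N j * (2 * s j) ^ k / (w j)\<^sup>2)"
    using C by (auto simp: good_def)
  define R where "R b = (case b of (j, x, i) \<Rightarrow> 6 * (2 ^ i * s j))" for b :: "nat \<times> 'e \<times> nat"
  define V where "V b = (case b of (j, x, i) \<Rightarrow> {y\<in>F' j. d x y \<le> 3 * (2 ^ i * s j)})" for b :: "nat \<times> 'e \<times> nat"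
  have block: "(\<Sum>b\<in>C j. R (j, b) powr t) \<le> C0 * (\<Sum>i\<in>K j. s (lev i) powr u)" for j
  proof -
    have "R (j, b) powr t = (6 * s j) powr t * 2 powr (real (snd b) * t)" for b
    proof -
      have "R (j, b) = (6 * s j) * 2 powr real (snd b)"
        by (cases b) (simp add: R_def powr_realpow)
      then show ?thesis using s0[of j] by (simp add: powr_mult powr_powr)
    qed
    then have "(\<Sum>b\<in>C j. R (j, b) powr t) = (6 * s j) powr t * (\<Sum>(x, i)\<in>C j. 2 powr (real i * t))"
      by (simp add: sum_distrib_left case_prod_beta)
    also have "\<dots> \<le> (6 * s j) powr t * (2 * (B * N j * (2 * s j) ^ k / (w j)\<^sup>2))"
      by (intro mult_left_mono Csum) auto
    also have "\<dots> = C0 * N j * (s j powr t * s j ^ k / (q ^ j)\<^sup>2)"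
    proof -
      define v p where "v = (1 - q)\<^sup>2" and "p = (q ^ j)\<^sup>2"
      have wj: "(w j)\<^sup>2 = v * p / 4" by (simp add: w_def v_def p_def power_mult_distrib power_divide)
      have C0v: "C0 = 6 powr t * 2 * B * 2 ^ k * 4 / v" by (simp add: C0_def v_def)
      have "v \<noteq> 0" "p \<noteq> 0" using q by (auto simp: v_def p_def)
      then show ?thesis
        using s0[of j] unfolding p_def[symmetric] wj C0v by (simp add: powr_mult power_mult_distrib)
    qed
    also have "s j powr t * s j ^ k / (q ^ j)\<^sup>2 = s j powr u"
    proof -
      have s2: "s j = 2 powr (- real j)" by (simp add: s_def powr_minus powr_realpow power_one_over inverse_eq_divide)
      have "q ^ j = q powr real j" using q by (simp add: powr_realpow)
      then have "(q ^ j)\<^sup>2 = q powr (real j + real j)" unfolding powr_add by (simp add: power2_eq_square)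
      also have "\<dots> = 2 powr (- (t + real k - u) / 2 * (real j + real j))"
        unfolding q_def by (rule powr_powr)
      also have "- (t + real k - u) / 2 * (real j + real j) = - real j * (t + real k - u)"
        by (simp add: field_simps)
      also have "2 powr \<dots> = s j powr (t + real k - u)"
        unfolding s2 by (rule powr_powr[symmetric])
      finally have q2: "(q ^ j)\<^sup>2 = s j powr (t + real k - u)" .
      have "s j ^ k = s j powr real k" using s0[of j] by (simp add: powr_realpow)
      then have "s j powr t * s j ^ k / (q ^ j)\<^sup>2 = s j powr (t + real k - (t + real k - u))"
        using s0[of j] unfolding q2 by (simp only: powr_add powr_diff)
      then show ?thesis by simp
    qed
    also have "C0 * N j * s j powr u = C0 * (\<Sum>i\<in>K j. s (lev i) powr u)"
      by (simp add: N_def K_def)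
    finally show ?thesis .
  qed
  show "\<exists>(J :: (nat \<times> 'e \<times> nat) set) U r. countable J \<and>
       (\<forall>j\<in>J. U j \<subseteq> F \<and> 0 \<le> r j \<and> (\<forall>x\<in>U j. \<forall>y\<in>U j. d x y \<le> r j)) \<and> F \<subseteq> (\<Union>j\<in>J. U j) \<and>
       (\<forall>G. finite G \<longrightarrow> G \<subseteq> J \<longrightarrow> (\<Sum>j\<in>G. r j powr t) \<le> \<epsilon>)"
  proof (intro exI[of _ "Sigma UNIV C"] exI[of _ V] exI[of _ R] conjI ballI allI impI)
    show "countable (Sigma UNIV C)" using fC by (intro countable_SIGMA) (auto intro: countable_finite)
    show "F \<subseteq> (\<Union>b\<in>Sigma UNIV C. V b)"
    proof
      fix e assume "e \<in> F"
      then obtain j where j: "e \<in> F' j" using cover by blast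
      then obtain b where "b \<in> C j" "e \<in> V (j, b)" using Ccov[of j] by (fastforce simp: V_def)
      then show "e \<in> (\<Union>b\<in>Sigma UNIV C. V b)" by blast
    qed
    fix G assume G: "finite G" "G \<subseteq> Sigma UNIV C"
    have "(\<Sum>b\<in>G. R b powr t) \<le> (\<Sum>b\<in>Sigma (fst ` G) C. R b powr t)"
      using G fC by (intro sum_mono2) (auto intro: rev_image_eqI)
    also have "\<dots> = (\<Sum>j\<in>fst ` G. \<Sum>b\<in>C j. R (j, b) powr t)"
      using G fC by (subst sum.Sigma) auto
    also have "\<dots> \<le> (\<Sum>j\<in>fst ` G. C0 * (\<Sum>i\<in>K j. s (lev i) powr u))" by (intro sum_mono block)
    also have "\<dots> = C0 * (\<Sum>j\<in>fst ` G. \<Sum>i\<in>K j. s (lev i) powr u)" by (simp add: sum_distrib_left)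
    also have "(\<Sum>j\<in>fst ` G. \<Sum>i\<in>K j. s (lev i) powr u) = (\<Sum>i\<in>(\<Union>j\<in>fst ` G. K j). s (lev i) powr u)"
      using G fK by (intro sum.UNION_disjoint[symmetric]) (auto simp: K_def)
    also have "C0 * \<dots> \<le> C0 * (2 powr u * \<epsilon>')"
      using C0 G fK by (intro mult_left_mono ssum) auto
    also have "\<dots> \<le> C0 * (2 powr u * (\<epsilon> / (C0 * 2 powr u)))"
      using C0 by (intro mult_left_mono) (auto simp: \<epsilon>'_def)
    also have "\<dots> = \<epsilon>" using C0 by simp
    finally show "(\<Sum>b\<in>G. R b powr t) \<le> \<epsilon>" .
  next
    fix b assume b: "b \<in> Sigma UNIV C"
    show "V b \<subseteq> F" by (auto simp: V_def F'_def split: prod.splits)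
    show "0 \<le> R b" using s0 by (auto simp: R_def less_imp_le split: prod.splits)
    fix y y' assume y: "y \<in> V b" "y' \<in> V b"
    obtain j x i where bj: "b = (j, x, i)" by (cases b)
    have "x \<in> F" "y \<in> F" "y' \<in> F" using b y CF[of j] by (auto simp: bj V_def F'_def)
    then show "d y y' \<le> R b"
      using y triangle[of y x y'] commute[of x y] by (simp add: bj V_def R_def)
  qed
qed

text \<open>The shadows of a cover of one graph must cover the unit cube.\<close>

lemma not_null_at_point_set:
  assumes e: "e \<in> F" and u: "0 < u" "u \<le> real (card I)"
    and X: "\<And>x. x \<in> cbox 0 1 \<Longrightarrow> \<phi> e x \<in> X"
  shows "\<not> null_at UNIV dist u X"
proof
  assume N: "null_at UNIV dist u X"
  define k where "k = card I"
  have \<epsilon>: "(0 :: real) < 1 / (2 * 2 ^ k)" by simp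
  obtain U :: "nat \<Rightarrow> (real ^ 'n) set" and r where U: "\<And>i. 0 < r i"
       "\<And>i x y. x \<in> U i \<Longrightarrow> y \<in> U i \<Longrightarrow> dist x y \<le> r i" "X \<subseteq> (\<Union>i. U i)"
       and rs: "\<And>F. finite F \<Longrightarrow> (\<Sum>i\<in>F. r i powr u) \<le> 1 / (2 * 2 ^ k)"
    by (rule null_atE[OF N \<epsilon>]) (rule that)
  have r1: "r i \<le> 1" for i
  proof (rule ccontr)
    assume "\<not> r i \<le> 1"
    then have "1 < r i powr u" using u by (simp add: gr_one_powr)
    moreover have "1 * 1 \<le> 2 * (2 :: real) ^ k" by (intro mult_mono) auto
    then have "1 / (2 * 2 ^ k) \<le> (1 :: real)" by simp
    moreover have "r i powr u \<le> 1 / (2 * 2 ^ k)" using rs[of "{i}"] by simp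
    ultimately show False by linarith
  qed
  define z where "z i = (SOME z. z \<in> U i)" for i
  define A where "A i = cball (z i) (r i)" for i
  have UA: "U i \<subseteq> A i" for i
  proof
    fix x assume x: "x \<in> U i"
    then have "z i \<in> U i" unfolding z_def by (rule someI)
    then have "dist (z i) x \<le> r i" using x by (rule U(2))
    then show "x \<in> A i" by (simp add: A_def)
  qed
  define D where "D = disjointed A"
  have "range A \<subseteq> sets borel" by (auto simp: A_def)
  then have "range D \<subseteq> sets borel" unfolding D_def by (rule sets.range_disjointed_sets)
  then have Db: "D i \<in> sets borel" for i by auto
  have S: "(\<lambda>i. measure lborel (hits e (D i))) sums 1"
  proof (rule hits_sums[OF e Db])
    show "disjoint_family D" unfolding D_def by (rule disjoint_family_disjointed)
    show "\<phi> e x \<in> (\<Union>i. D i)" if "x \<in> cbox 0 1" for x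
      unfolding D_def UN_disjointed_eq
      using X[OF that] subset_trans[OF U(3) UN_mono[OF subset_refl UA]] by blast
  qed
  have le: "measure lborel (hits e (D i)) \<le> 2 ^ k * r i powr u" for i
  proof -
    have "D i \<subseteq> cball (z i) (r i)" using disjointed_subset[of A i] by (simp add: D_def A_def)
    then have "measure lborel (hits e (D i)) \<le> measure lborel (shadow_box I (z i) (r i))"
      using hits_borel[OF e Db] e
      by (intro measure_mono_fmeasurable hits_subset_shadow_box) (auto simp: shadow_box_def)
    also have "\<dots> = 2 ^ k * r i ^ k"
      using U(1) by (simp add: measure_shadow_box k_def power_mult_distrib)
    also have "r i ^ k = r i powr real k" using U(1)[of i] by (simp add: powr_realpow)
    also have "\<dots> \<le> r i powr u"
      using U(1)[of i] r1[of i] u by (intro powr_mono') (auto simp: k_def less_imp_le)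
    finally show ?thesis by simp
  qed
  have "(\<Sum>i. measure lborel (hits e (D i))) \<le> 1/2"
  proof (rule suminf_le_const[OF sums_summable[OF S]])
    fix n
    have "(\<Sum>i<n. measure lborel (hits e (D i))) \<le> 2 ^ k * (\<Sum>i<n. r i powr u)"
      unfolding sum_distrib_left by (intro sum_mono le)
    also have "\<dots> \<le> 2 ^ k * (1 / (2 * 2 ^ k))" by (intro mult_left_mono rs) auto
    finally show "(\<Sum>i<n. measure lborel (hits e (D i))) \<le> 1/2" by simp
  qed
  then show False using sums_unique[OF S] by simp
qed

end


section \<open>Planes as graphs over coordinate subspaces\<close>

text \<open>The plane \<open>P\<close> is the graph of an affine map over the coordinates in \<open>I\<close>: \<open>A\<close> is the projection
  onto the direction of \<open>P\<close> along the remaining coordinate axes, and \<open>x \<mapsto> A x + b\<close> returns the point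
  of \<open>P\<close> with the same \<open>I\<close>-coordinates as \<open>x\<close>. Keeping the parameter \<open>x\<close> in the ambient space avoids
  a separate space of dimension \<open>card I\<close>.\<close>

definition graph_over :: "'n set \<Rightarrow> (real ^ 'n \<Rightarrow> real ^ 'n) \<Rightarrow> real ^ 'n \<Rightarrow> (real ^ 'n) set \<Rightarrow> bool" where
  "graph_over I A b P \<longleftrightarrow> linear A \<and> range A = direction P \<and> (\<forall>x. A (A x) = A x) \<and>
     (\<forall>x. \<forall>i\<in>I. A x $ i = x $ i) \<and> b \<in> P \<and> (\<forall>i\<in>I. b $ i = 0)"

text \<open>A maximal coordinate subspace that meets the direction only in \<open>0\<close> is a complement of it, since
  otherwise some axis vector outside the sum could be adjoined.\<close>

lemma exists_graph_over:
  fixes P :: "(real ^ 'n) set"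
  assumes "P \<in> affine_grassmannian k"
  shows "\<exists>I A b. card I = k \<and> graph_over I A b P"
proof -
  obtain V a where V: "subspace V" "dim V = k" and P: "P = (+) a ` V"
    using assms by (auto simp: affine_grassmannian_iff)
  have dP: "direction P = V" using V P by (simp add: direction_translate)
  define cs where "cs J = {x :: real ^ 'n. \<forall>i. i \<notin> J \<longrightarrow> x $ i = 0}" for J :: "'n set"
  have cs: "subspace (cs J)" for J by (auto simp: cs_def subspace_def)
  have "V \<inter> cs {} = {0}"
    using subspace_0[OF V(1)] by (auto simp: cs_def vec_eq_iff)
  moreover have "\<forall>J :: 'n set. V \<inter> cs J = {0} \<longrightarrow> card J < CARD('n) + 1"
    by (simp add: card_mono less_Suc_eq_le)
  ultimately obtain J where J: "V \<inter> cs J = {0}"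
    and max: "\<forall>K. V \<inter> cs K = {0} \<longrightarrow> card K \<le> card J"
    using ex_has_greatest_nat[of "\<lambda>J. V \<inter> cs J = {0}" "{}" card "CARD('n) + 1"] by blast
  define Z where "Z = {x + y |x y. x \<in> V \<and> y \<in> cs J}"
  have Z: "subspace Z" unfolding Z_def by (rule subspace_sums[OF V(1) cs])
  have csZ: "y \<in> Z" if "y \<in> cs J" for y
    using that subspace_0[OF V(1)] unfolding Z_def by (metis (mono_tags, lifting) add_0 mem_Collect_eq)
  have axZ: "axis i 1 \<in> Z" for i
  proof (cases "i \<in> J")
    case True
    then show ?thesis by (intro csZ) (auto simp: cs_def axis_def)
  next
    case False
    then have "V \<inter> cs (insert i J) \<noteq> {0}" using max[rule_format, of "insert i J"] by auto
    moreover have "0 \<in> V \<inter> cs (insert i J)" using subspace_0[OF V(1)] by (simp add: cs_def)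
    ultimately have "\<not> V \<inter> cs (insert i J) \<subseteq> {0}" by blast
    then obtain v where v: "v \<in> V" "v \<in> cs (insert i J)" "v \<noteq> 0" by blast
    define c where "c = v $ i"
    have c: "c \<noteq> 0"
    proof
      assume "c = 0"
      then have "v \<in> cs J" using v(2) by (auto simp: cs_def c_def)
      then show False using J v by auto
    qed
    have "c *\<^sub>R axis i 1 - v \<in> cs J"
      using v(2) by (auto simp: cs_def c_def axis_def)
    then have "v + (c *\<^sub>R axis i 1 - v) \<in> Z" unfolding Z_def using v(1) by blast
    then have "c *\<^sub>R axis i 1 \<in> Z" by simp
    then have "(1 / c) *\<^sub>R (c *\<^sub>R axis i 1) \<in> Z" by (rule subspace_scale[OF Z])
    then show ?thesis using c by simp
  qed
  have ZU: "Z = UNIV"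
  proof -
    have "x \<in> Z" for x
    proof -
      have "(\<Sum>i\<in>UNIV. (x $ i) *\<^sub>R axis i 1) \<in> Z"
        by (intro subspace_sum[OF Z] subspace_scale[OF Z] axZ)
      moreover have "(\<Sum>i\<in>UNIV. (x $ i) *\<^sub>R axis i 1) = x"
        using basis_expansion[of x] by (simp add: scalar_mult_eq_scaleR)
      ultimately show ?thesis by simp
    qed
    then show ?thesis by auto
  qed
  have cardJ: "card (- J) = k"
  proof -
    have "dim Z + dim (V \<inter> cs J) = dim V + dim (cs J)"
      unfolding Z_def by (rule dim_sums_Int[OF V(1) cs])
    moreover have "dim (cs J) = card J" unfolding cs_def dim_vec_eq[symmetric] by (rule dim_substandard_cart)
    ultimately have "CARD('n) = k + card J" using J V(2) ZU by simp
    then show ?thesis by (simp add: Compl_eq_Diff_UNIV card_Diff_subset)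
  qed
  have "\<exists>v. v \<in> V \<and> x - v \<in> cs J" for x
  proof -
    have "x \<in> Z" using ZU by simp
    then obtain v y where "v \<in> V" "y \<in> cs J" "x = v + y" by (auto simp: Z_def)
    then show ?thesis by (intro exI[of _ v]) simp
  qed
  then obtain A where A: "\<And>x. A x \<in> V" "\<And>x. x - A x \<in> cs J" by metis
  have uniq: "A x = v" if "v \<in> V" "x - v \<in> cs J" for x v
  proof -
    have "A x - v \<in> V" using A(1) that(1) V(1) subspace_diff by blast
    moreover have "(x - v) - (x - A x) \<in> cs J" by (intro subspace_diff[OF cs] A that)
    ultimately have "A x - v \<in> V \<inter> cs J" by simp
    then show ?thesis using J by simp
  qed
  have fixed: "A v = v" if "v \<in> V" for v using uniq[OF that] subspace_0[OF cs] by simp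
  have lin: "linear A"
  proof (rule linearI)
    fix x y and c :: real
    have "x + y - (A x + A y) = (x - A x) + (y - A y)" by simp
    also have "\<dots> \<in> cs J" by (intro subspace_add[OF cs] A)
    finally show "A (x + y) = A x + A y" by (intro uniq subspace_add[OF V(1)] A)
    have "c *\<^sub>R x - c *\<^sub>R A x = c *\<^sub>R (x - A x)" by (simp add: scaleR_diff_right)
    also have "\<dots> \<in> cs J" by (intro subspace_scale[OF cs] A)
    finally show "A (c *\<^sub>R x) = c *\<^sub>R A x" by (intro uniq subspace_scale[OF V(1)] A)
  qed
  have coord: "A x $ i = x $ i" if "i \<in> - J" for x i
    using A(2)[of x] that by (simp add: cs_def)
  have "a - A a = a + (- A a)" "- A a \<in> V" using A(1) subspace_neg[OF V(1)] by auto
  then have "a - A a \<in> P" unfolding P by blast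
  moreover have "range A = V" using A(1) fixed by (metis image_subset_iff rangeI subsetI subset_antisym)
  ultimately have "graph_over (- J) A (a - A a) P"
    using lin fixed A(1) coord by (simp add: graph_over_def dP)
  with cardJ show ?thesis by blast
qed

lemma graph_over_mem:
  assumes "P \<in> affine_grassmannian k" "graph_over I A b P"
  shows "A x + b \<in> P"
proof -
  obtain V a where V: "subspace V" and P: "P = (+) a ` V"
    using assms by (auto simp: affine_grassmannian_iff)
  have "A x \<in> V" using assms(2) V P by (auto simp: graph_over_def direction_translate)
  moreover obtain v where v: "v \<in> V" "b = a + v" using assms(2) P by (auto simp: graph_over_def)
  moreover have "A x + b = a + (A x + v)" using v by simp
  ultimately show ?thesis unfolding P using subspace_add[OF V] by blast
qed

lemma norm_orth_proj_le:
  fixes V :: "(real ^ 'n) set"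
  assumes V: "subspace V" and w: "w \<in> V"
  shows "norm (x - orth_proj V x) \<le> norm (x - w)" "norm (orth_proj V x) \<le> norm x"
    "norm (x - orth_proj V x) \<le> norm x"
proof -
  have dec: "norm (x - u) ^ 2 = norm (x - orth_proj V x) ^ 2 + norm (orth_proj V x - u) ^ 2" if "u \<in> V" for u
  proof -
    have "orth_proj V x - u \<in> V" using that orth_proj(1)[OF V] V subspace_diff by blast
    then have o: "orthogonal (x - orth_proj V x) (orth_proj V x - u)"
      using orth_proj(2)[OF V, of x] by (auto simp: orthogonal_comp_def orthogonal_commute)
    show ?thesis using norm_add_Pythagorean[OF o] by simp
  qed
  show "norm (x - orth_proj V x) \<le> norm (x - w)"
    by (rule power2_le_imp_le) (simp_all add: dec[OF w])
  have "norm x ^ 2 = norm (x - orth_proj V x) ^ 2 + norm (orth_proj V x) ^ 2"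
    using dec[OF subspace_0[OF V]] by simp
  then show "norm (orth_proj V x) \<le> norm x" "norm (x - orth_proj V x) \<le> norm x"
    by (auto intro: power2_le_imp_le[OF _ norm_ge_zero])
qed

lemma foot_eq:
  assumes "P \<in> affine_grassmannian k" "b \<in> P"
  shows "foot P = b - orth_proj (direction P) b"
proof -
  obtain V a where V: "subspace V" "a \<in> V\<^sup>\<bottom>" and P: "P = (+) a ` V"
    using assms by (auto simp: affine_grassmannian_iff)
  obtain v where v: "v \<in> V" "b = a + v" using assms(2) P by auto
  then have "orth_proj V b = v" using V by (intro orth_proj_unique) auto
  then show ?thesis using P V v by (simp add: foot_translate direction_translate)
qed

text \<open>For orthogonal projections, \<open>\<pi>\<^sub>V - \<pi>\<^sub>W = \<pi>\<^sub>V (1 - \<pi>\<^sub>W) - (1 - \<pi>\<^sub>V) \<pi>\<^sub>W\<close>. On \<open>W\<close> the second term is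
  bounded by the distance from \<open>w = B w\<close> to \<open>A w \<in> V\<close>, and the first is the adjoint of the
  same expression with the roles of \<open>V\<close> and \<open>W\<close> exchanged. The feet are the projections of \<open>b\<close>
  and \<open>c\<close> to the orthogonal complements.\<close>

lemma aff_dist_le_graph_dist:
  fixes P Q :: "(real ^ 'n) set"
  assumes P: "P \<in> affine_grassmannian k" "graph_over I A b P"
    and Q: "Q \<in> affine_grassmannian k" "graph_over I B c Q"
    and R: "norm c \<le> R"
  shows "aff_dist P Q \<le> (2 + 2 * R) * (onorm (\<lambda>x. A x - B x) + norm (b - c))"
proof -
  define V W where "V = direction P" and "W = direction Q"
  define \<delta> where "\<delta> = onorm (\<lambda>x. A x - B x)"
  have V: "subspace V" and W: "subspace W" by (simp_all add: V_def W_def subspace_direction)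
  have lin: "linear A" "linear B" and rA: "range A = V" and rB: "range B = W"
    and idem: "\<And>x. A (A x) = A x" "\<And>x. B (B x) = B x"
    using P(2) Q(2) by (auto simp: graph_over_def V_def W_def)
  have bl: "bounded_linear (\<lambda>x. A x - B x)"
    using lin by (intro bounded_linear_sub) (auto simp: linear_conv_bounded_linear)
  have d: "norm (A x - B x) \<le> \<delta> * norm x" for x using onorm[OF bl] by (simp add: \<delta>_def)
  have d0: "0 \<le> \<delta>" unfolding \<delta>_def by (rule onorm_pos_le[OF bl])
  have AV: "A v = v" if "v \<in> V" for v using that rA idem by auto
  have BW: "B w = w" if "w \<in> W" for w using that rB idem by auto
  have bound: "norm (orth_proj V x - orth_proj W x) \<le> 2 * \<delta> * norm x" for x
  proof -
    define y z where "y = orth_proj W x" and "z = x - y"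
    define q where "q = orth_proj V z"
    have y: "y \<in> W" "norm y \<le> norm x" and z: "z \<in> W\<^sup>\<bottom>" "norm z \<le> norm x"
      using orth_proj[OF W] norm_orth_proj_le[OF W subspace_0[OF W]] by (auto simp: y_def z_def)
    have "norm (y - orth_proj V y) \<le> norm (y - A y)"
      using rA by (intro norm_orth_proj_le V) auto
    also have "\<dots> = norm (A y - B y)" using BW[OF y(1)] by (simp add: norm_minus_commute)
    also have "\<dots> \<le> \<delta> * norm y" by (rule d)
    also have "\<dots> \<le> \<delta> * norm x" using y(2) d0 by (rule mult_left_mono)
    finally have 1: "norm (y - orth_proj V y) \<le> \<delta> * norm x" .
    have q: "q \<in> V" "z - q \<in> V\<^sup>\<bottom>" using orth_proj[OF V] by (auto simp: q_def)
    have "q \<bullet> q = q \<bullet> z"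
      using q by (auto simp: orthogonal_comp_def orthogonal_def inner_diff_right)
    also have "\<dots> = (A q - B q) \<bullet> z"
    proof -
      have "B q \<bullet> z = 0" using z(1) rB by (auto simp: orthogonal_comp_def orthogonal_def)
      then show ?thesis using AV[OF q(1)] by (simp add: inner_diff_left)
    qed
    also have "\<dots> \<le> norm (A q - B q) * norm z" by (rule norm_cauchy_schwarz)
    also have "\<dots> \<le> (\<delta> * norm q) * norm x" using d[of q] z(2) d0 by (intro mult_mono) auto
    finally have "norm q * norm q \<le> norm q * (\<delta> * norm x)"
      by (simp add: power2_norm_eq_inner[symmetric] power2_eq_square mult_ac)
    then have 2: "norm q \<le> \<delta> * norm x"
      using d0 by (cases "norm q = 0") (auto simp: mult_le_cancel_left)
    have "orth_proj V x = orth_proj V y + q"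
      using linear_add[OF linear_orth_proj[OF V], of y z] by (simp add: q_def z_def)
    then have "orth_proj V x - orth_proj W x = q - (y - orth_proj V y)" by (simp add: y_def)
    then show ?thesis using norm_triangle_ineq4[of q "y - orth_proj V y"] 1 2 by simp
  qed
  have "onorm (\<lambda>x. orth_proj V x - orth_proj W x) \<le> 2 * \<delta>" by (rule onorm_le) (rule bound)
  moreover have "norm (foot P - foot Q) \<le> norm (b - c) + 2 * \<delta> * R"
  proof -
    have "foot P - foot Q = ((b - c) - orth_proj V (b - c)) - (orth_proj V c - orth_proj W c)"
      using P(2) Q(2) foot_eq[OF P(1), of b] foot_eq[OF Q(1), of c] linear_diff[OF linear_orth_proj[OF V], of b c]
      by (simp add: graph_over_def V_def W_def)
    then have "norm (foot P - foot Q) \<le> norm (b - c) + norm (orth_proj V c - orth_proj W c)"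
      using norm_triangle_ineq4 norm_orth_proj_le(3)[OF V subspace_0[OF V], of "b - c"]
      by (metis add_right_mono order_trans)
    also have "norm (orth_proj V c - orth_proj W c) \<le> 2 * \<delta> * R"
      using bound[of c] R d0 by (meson mult_left_mono mult_nonneg_nonneg order_trans zero_le_numeral)
    finally show ?thesis by simp
  qed
  ultimately have "aff_dist P Q \<le> 2 * \<delta> + (norm (b - c) + 2 * \<delta> * R)"
    unfolding aff_dist_def V_def W_def by simp
  also have "\<dots> \<le> (2 + 2 * R) * (\<delta> + norm (b - c))"
  proof -
    have "0 \<le> R" using R norm_ge_zero order_trans by blast
    then have "0 \<le> (1 + 2 * R) * norm (b - c)" by simp
    then show ?thesis by (simp add: algebra_simps)
  qed
  finally show ?thesis by (simp add: \<delta>_def)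
qed


section \<open>The upper bound\<close>

lemma aff_dist_bounds:
  "onorm (\<lambda>x. orth_proj (direction P) x - orth_proj (direction Q) x) \<le> aff_dist P Q"
  "norm (foot P - foot Q) \<le> aff_dist P Q"
  unfolding aff_dist_def using onorm_pos_le[OF bounded_linear_orth_proj_diff[of P Q]] by simp_all

text \<open>The metric compares projections and feet, which are the linear part and the value at \<open>0\<close> of the
  orthogonal projection onto a plane.\<close>

lemma move_to_plane:
  assumes P: "P \<in> affine_grassmannian k" "y \<in> P" and R: "norm y \<le> R"
  shows "norm (y - (foot Q + orth_proj (direction Q) y)) \<le> (R + 1) * aff_dist P Q"
proof -
  have y: "y = foot P + orth_proj (direction P) y" using foot_eq[OF P] by simp
  have "y - (foot Q + orth_proj (direction Q) y) =
      (foot P - foot Q) + (orth_proj (direction P) y - orth_proj (direction Q) y)"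
    by (subst y) simp
  then have "norm (y - (foot Q + orth_proj (direction Q) y)) \<le>
      norm (foot P - foot Q) + norm (orth_proj (direction P) y - orth_proj (direction Q) y)"
    using norm_triangle_ineq by metis
  also have "norm (orth_proj (direction P) y - orth_proj (direction Q) y) \<le> aff_dist P Q * R"
  proof -
    have "norm (orth_proj (direction P) y - orth_proj (direction Q) y)
        \<le> onorm (\<lambda>x. orth_proj (direction P) x - orth_proj (direction Q) x) * norm y"
      by (rule onorm[OF bounded_linear_orth_proj_diff])
    also have "\<dots> \<le> aff_dist P Q * R"
      using aff_dist_bounds[of P Q] R by (intro mult_mono) (auto intro: order_trans[OF norm_ge_zero])
    finally show ?thesis .
  qed
  also have "norm (foot P - foot Q) \<le> aff_dist P Q" by (rule aff_dist_bounds)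
  finally show ?thesis by (simp add: algebra_simps)
qed

lemma abs_diff_le_if_floor_eq:
  fixes x y r :: real
  assumes "0 < r" "\<lfloor>x / r\<rfloor> = \<lfloor>y / r\<rfloor>"
  shows "\<bar>x - y\<bar> \<le> r"
proof -
  have "\<bar>x / r - y / r\<bar> \<le> 1" using assms(2) by linarith
  then show ?thesis using assms(1) by (simp add: diff_divide_distrib[symmetric] abs_divide)
qed

text \<open>The planes in a set \<open>U i\<close> of diameter \<open>r i\<close> stay, within \<open>cball 0 R\<close>, in a neighbourhood of width
  of order \<open>r i\<close> of a single one of them. Cutting that plane into cubes of side \<open>r i\<close> with respect to
  an orthonormal basis gives of order \<open>1 / (r i)\<^sup>k\<close> sets of diameter of order \<open>r i\<close>.\<close>

lemma null_at_union_of_planes: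
  fixes E :: "(real ^ 'n) set set"
  assumes E: "E \<subseteq> affine_grassmannian k" and t: "0 < t" and R: "0 \<le> R"
    and N: "null_at (affine_grassmannian k) aff_dist t E"
  shows "null_at UNIV dist (t + real k) (\<Union>E \<inter> cball 0 R)"
proof (rule null_atI)
  show "0 < t + real k" using t by simp
  fix \<epsilon> :: real assume \<epsilon>: "0 < \<epsilon>"
  define C where "C = 2 * (R + 1) + real k"
  have C: "0 < C" using R by (simp add: C_def)
  define C1 where "C1 = (2 * R + 3) ^ k * C powr (t + real k)"
  have C1: "0 < C1" using R C by (simp add: C1_def)
  define \<epsilon>' where "\<epsilon>' = min 1 (\<epsilon> / C1)"
  have \<epsilon>': "0 < \<epsilon>'" using \<epsilon> C1 by (simp add: \<epsilon>'_def)
  obtain U :: "nat \<Rightarrow> (real ^ 'n) set set" and r where UA: "\<And>i. U i \<subseteq> affine_grassmannian k"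
       and r0: "\<And>i. 0 < r i" and Ud: "\<And>i x y. x \<in> U i \<Longrightarrow> y \<in> U i \<Longrightarrow> aff_dist x y \<le> r i"
       and EU: "E \<subseteq> (\<Union>i. U i)"
       and rs: "\<And>F. finite F \<Longrightarrow> (\<Sum>i\<in>F. r i powr t) \<le> \<epsilon>'"
    by (rule null_atE[OF N \<epsilon>']) (rule that)
  have r1: "r i \<le> 1" for i
  proof (rule ccontr)
    assume "\<not> r i \<le> 1"
    then have "1 < r i powr t" using t by (simp add: gr_one_powr)
    then show False using rs[of "{i}"] by (simp add: \<epsilon>'_def)
  qed
  have basis: "\<exists>B. B \<subseteq> direction Q \<and> pairwise orthogonal B \<and> (\<forall>w\<in>B. norm w = 1) \<and> finite B \<and> card B = k \<and> span B = direction Q"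
    if Q: "Q \<in> affine_grassmannian k" for Q :: "(real ^ 'n) set"
  proof -
    have "dim (direction Q) = k" using Q by (auto simp: affine_grassmannian_iff direction_translate)
    moreover obtain B where "B \<subseteq> direction Q" "pairwise orthogonal B" "\<And>w. w \<in> B \<Longrightarrow> norm w = 1"
        "independent B" "card B = dim (direction Q)" "span B = direction Q"
      using orthonormal_basis_subspace[OF subspace_direction] by blast
    ultimately show ?thesis using independent_imp_finite by blast
  qed
  define Q where "Q i = (SOME Q. Q \<in> U i)" for i
  have QU: "Q i \<in> U i" if "U i \<noteq> {}" for i using that unfolding Q_def by (rule some_in_eq[THEN iffD2])
  have "\<forall>i. \<exists>B. U i \<noteq> {} \<longrightarrow> B \<subseteq> direction (Q i) \<and> pairwise orthogonal B \<and> (\<forall>w\<in>B. norm w = 1) \<and> finite B \<and> card B = k \<and> span B = direction (Q i)"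
    using basis QU UA by blast
  then obtain B where B: "\<And>i. U i \<noteq> {} \<Longrightarrow> B i \<subseteq> direction (Q i) \<and> pairwise orthogonal (B i) \<and> (\<forall>w\<in>B i. norm w = 1) \<and> finite (B i) \<and> card (B i) = k \<and> span (B i) = direction (Q i)"
    by metis
  \<comment> \<open>A cell collects the points whose coordinates in an orthonormal basis of the direction of \<open>Q i\<close>
    have the same integer parts in units of \<open>r i\<close>; within \<open>cball 0 R\<close> these parts range over
    \<open>{- m i..m i}\<close>.\<close>
  define m where "m i = \<lceil>R / r i\<rceil>" for i
  define cell where "cell i y = restrict (\<lambda>w. \<lfloor>(w \<bullet> y) / r i\<rfloor>) (B i)" for i and y :: "real ^ 'n"
  define K where "K i = (B i \<rightarrow>\<^sub>E {- m i .. m i})" for i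
  define V where "V p = {y \<in> cball 0 R. cell (fst p) y = snd p \<and> y \<in> \<Union>(U (fst p))}" for p
  define \<rho> where "\<rho> p = C * r (fst p)" for p :: "nat \<times> (real ^ 'n \<Rightarrow> int)"
  have cellK: "cell i y \<in> K i" if "U i \<noteq> {}" "norm y \<le> R" for i y
  proof -
    have "\<lfloor>(w \<bullet> y) / r i\<rfloor> \<in> {- m i .. m i}" if w: "w \<in> B i" for w
    proof -
      have "\<bar>w \<bullet> y\<bar> \<le> norm w * norm y" by (rule Cauchy_Schwarz_ineq2)
      also have "\<dots> \<le> R" using B[OF \<open>U i \<noteq> {}\<close>] w \<open>norm y \<le> R\<close> by simp
      finally have "\<bar>(w \<bullet> y) / r i\<bar> \<le> R / r i"
        using r0[of i] by (simp add: abs_divide divide_right_mono)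
      then show ?thesis unfolding m_def atLeastAtMost_iff by linarith
    qed
    then show ?thesis by (auto simp: cell_def K_def)
  qed
  have fK: "finite (K i)" and cardK: "real (card (K i)) \<le> ((2 * R + 3) / r i) ^ k" if "U i \<noteq> {}" for i
  proof -
    show "finite (K i)" unfolding K_def using B[OF that] by (intro finite_PiE) auto
    have "0 \<le> R / r i" using R r0[of i] by simp
    then have "0 \<le> m i" unfolding m_def by linarith
    then have "real (card {- m i .. m i}) = 2 * of_int (m i) + 1" by simp
    also have "\<dots> \<le> 2 * (R / r i) + 3" unfolding m_def by linarith
    also have "\<dots> \<le> (2 * R + 3) / r i" using r0[of i] r1[of i] by (simp add: field_simps)
    finally have "real (card {- m i .. m i}) ^ k \<le> ((2 * R + 3) / r i) ^ k" by (intro power_mono) auto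
    then show "real (card (K i)) \<le> ((2 * R + 3) / r i) ^ k"
      unfolding K_def using B[OF that] by (simp add: card_PiE)
  qed
  have Vd: "dist y y' \<le> \<rho> p" if y: "y \<in> V p" "y' \<in> V p" for p y y'
  proof -
    define i where "i = fst p"
    obtain P P' where P: "P \<in> U i" "y \<in> P" "norm y \<le> R" and P': "P' \<in> U i" "y' \<in> P'" "norm y' \<le> R"
      using y by (auto simp: V_def i_def)
    have ne: "U i \<noteq> {}" using P by auto
    note Bi = B[OF ne]
    define W where "W = direction (Q i)"
    have W: "subspace W" by (simp add: W_def subspace_direction)
    define x where "x = y - y'"
    define q where "q = orth_proj W x"
    have near: "norm (z - (foot (Q i) + orth_proj W z)) \<le> (R + 1) * r i" if "Z \<in> U i" "z \<in> Z" "norm z \<le> R" for Z z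
    proof -
      have "norm (z - (foot (Q i) + orth_proj W z)) \<le> (R + 1) * aff_dist Z (Q i)"
        unfolding W_def using that UA[of i] by (intro move_to_plane) auto
      also have "\<dots> \<le> (R + 1) * r i" using Ud[OF that(1) QU[OF ne]] R by (intro mult_left_mono) auto
      finally show ?thesis .
    qed
    have qB: "\<bar>w \<bullet> q\<bar> \<le> r i" if w: "w \<in> B i" for w
    proof -
      have "w \<in> W" using Bi w by (auto simp: W_def)
      then have "w \<bullet> (x - q) = 0"
        using orth_proj(2)[OF W, of x] by (auto simp: q_def orthogonal_comp_def orthogonal_def)
      then have "w \<bullet> q = w \<bullet> y - w \<bullet> y'" by (simp add: x_def inner_diff_right)
      moreover have "cell i y w = cell i y' w" using y by (simp add: V_def i_def)
      then have "\<lfloor>(w \<bullet> y) / r i\<rfloor> = \<lfloor>(w \<bullet> y') / r i\<rfloor>" using w by (simp add: cell_def)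
      then have "\<bar>w \<bullet> y - w \<bullet> y'\<bar> \<le> r i" by (rule abs_diff_le_if_floor_eq[OF r0])
      ultimately show ?thesis by simp
    qed
    have "q \<in> span (B i)" using orth_proj(1)[OF W] Bi by (simp add: q_def W_def)
    then have "(\<Sum>w\<in>B i. (q \<bullet> w) *\<^sub>R w) = q"
      using Bi by (intro orthonormal_basis_expand) auto
    then have "q = (\<Sum>w\<in>B i. (w \<bullet> q) *\<^sub>R w)" by (simp add: inner_commute)
    then have "norm q \<le> (\<Sum>w\<in>B i. norm ((w \<bullet> q) *\<^sub>R w))" using norm_sum by metis
    also have "\<dots> \<le> (\<Sum>w\<in>B i. r i)" using Bi qB by (intro sum_mono) simp
    also have "\<dots> = real k * r i" using Bi by simp
    finally have nq: "norm q \<le> real k * r i" .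
    have "x = (y - (foot (Q i) + orth_proj W y)) - (y' - (foot (Q i) + orth_proj W y')) + q"
      using linear_diff[OF linear_orth_proj[OF W], of y y'] by (simp add: x_def q_def)
    then have "norm x \<le> norm ((y - (foot (Q i) + orth_proj W y)) - (y' - (foot (Q i) + orth_proj W y'))) + norm q"
      using norm_triangle_ineq by metis
    also have "norm ((y - (foot (Q i) + orth_proj W y)) - (y' - (foot (Q i) + orth_proj W y'))) \<le> (R + 1) * r i + (R + 1) * r i"
      by (rule order_trans[OF norm_triangle_ineq4 add_mono[OF near[OF P] near[OF P']]])
    finally have "norm x \<le> ((R + 1) * r i + (R + 1) * r i) + real k * r i" using nq by simp
    then show ?thesis by (simp add: \<rho>_def x_def i_def dist_norm C_def algebra_simps)
  qed
  define J where "J = Sigma {i. U i \<noteq> {}} K"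
  have block: "(\<Sum>g\<in>K i. \<rho> (i, g) powr (t + real k)) \<le> C1 * r i powr t" if "U i \<noteq> {}" for i
  proof -
    have "(\<Sum>g\<in>K i. \<rho> (i, g) powr (t + real k)) = real (card (K i)) * (C * r i) powr (t + real k)"
      by (simp add: \<rho>_def)
    also have "\<dots> \<le> ((2 * R + 3) / r i) ^ k * (C * r i) powr (t + real k)"
      by (intro mult_right_mono cardK that) auto
    also have "(C * r i) powr (t + real k) = C powr (t + real k) * (r i powr t * r i ^ k)"
      using C r0[of i] by (simp add: powr_mult powr_add powr_realpow)
    also have "((2 * R + 3) / r i) ^ k * (C powr (t + real k) * (r i powr t * r i ^ k)) = C1 * r i powr t"
      using r0[of i] by (simp add: C1_def power_divide)
    finally show ?thesis .
  qed
  show "\<exists>(J :: (nat \<times> (real ^ 'n \<Rightarrow> int)) set) U r. countable J \<and>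
       (\<forall>j\<in>J. U j \<subseteq> UNIV \<and> 0 \<le> r j \<and> (\<forall>x\<in>U j. \<forall>y\<in>U j. dist x y \<le> r j)) \<and> \<Union>E \<inter> cball 0 R \<subseteq> (\<Union>j\<in>J. U j) \<and>
       (\<forall>F. finite F \<longrightarrow> F \<subseteq> J \<longrightarrow> (\<Sum>j\<in>F. r j powr (t + real k)) \<le> \<epsilon>)"
  proof (intro exI[of _ J] exI[of _ V] exI[of _ \<rho>] conjI ballI allI impI)
    show "countable J" unfolding J_def using fK by (intro countable_SIGMA) (auto intro: countable_finite)
    show "\<Union>E \<inter> cball 0 R \<subseteq> (\<Union>p\<in>J. V p)"
    proof
      fix y assume y: "y \<in> \<Union>E \<inter> cball 0 R"
      then obtain P i where P: "y \<in> P" "P \<in> U i" using EU by blast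
      have "(i, cell i y) \<in> J" unfolding J_def using P y cellK[of i y] by auto
      moreover have "y \<in> V (i, cell i y)" using P y by (auto simp: V_def)
      ultimately show "y \<in> (\<Union>p\<in>J. V p)" by blast
    qed
    fix G assume G: "finite G" "G \<subseteq> J"
    have ne: "U i \<noteq> {}" if "i \<in> fst ` G" for i using that G(2) by (auto simp: J_def)
    have "(\<Sum>p\<in>G. \<rho> p powr (t + real k)) \<le> (\<Sum>p\<in>Sigma (fst ` G) K. \<rho> p powr (t + real k))"
      using G fK ne by (intro sum_mono2 finite_SigmaI) (auto simp: J_def intro: rev_image_eqI)
    also have "\<dots> = (\<Sum>i\<in>fst ` G. \<Sum>g\<in>K i. \<rho> (i, g) powr (t + real k))"
      using G fK ne by (subst sum.Sigma) auto
    also have "\<dots> \<le> (\<Sum>i\<in>fst ` G. C1 * r i powr t)" by (intro sum_mono block ne)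
    also have "\<dots> = C1 * (\<Sum>i\<in>fst ` G. r i powr t)" by (simp add: sum_distrib_left)
    also have "\<dots> \<le> C1 * \<epsilon>'" using C1 G by (intro mult_left_mono rs) auto
    also have "\<dots> \<le> C1 * (\<epsilon> / C1)" using C1 by (intro mult_left_mono) (auto simp: \<epsilon>'_def)
    also have "\<dots> = \<epsilon>" using C1 by simp
    finally show "(\<Sum>p\<in>G. \<rho> p powr (t + real k)) \<le> \<epsilon>" .
  next
    fix p show "0 \<le> \<rho> p" using C r0 by (simp add: \<rho>_def less_imp_le)
  qed (use Vd in auto)
qed


section \<open>The dimension of a union of planes\<close>

text \<open>The difference of two graph parametrisations is an affine map whose size controls the distance
  of the planes, so the sublevel estimate for affine maps is exactly the transversality required.\<close>

lemma transversal_family_graphs: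
  fixes F :: "(real ^ 'n) set set"
  assumes F: "F \<subseteq> affine_grassmannian k" and R: "0 \<le> R"
    and g: "\<And>P. P \<in> F \<Longrightarrow> graph_over I (A P) (b P) P" "\<And>P. P \<in> F \<Longrightarrow> norm (b P) \<le> R"
  shows "transversal_family F aff_dist (\<lambda>P x. A P x + b P) I
           ((2 + 2 * R) * (6 * (2 * real CARD('n) + 1) * 3 ^ CARD('n)))"
proof -
  interpret G: Metric_space "affine_grassmannian k :: (real ^ 'n) set set" aff_dist
    by (rule Metric_space_aff_dist)
  have lin: "linear (A P)" if "P \<in> F" for P using g(1)[OF that] by (simp add: graph_over_def)
  show ?thesis
  proof (intro transversal_family.intro transversal_family_axioms.intro)
    show "Metric_space F aff_dist" by (rule G.subspace[OF F])
    show "continuous_on UNIV (\<lambda>x. A P x + b P)" if "P \<in> F" for P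
      using lin[OF that] by (intro continuous_intros linear_continuous_on) (simp add: linear_conv_bounded_linear)
    show "(A P x + b P) $ i = x $ i" if "P \<in> F" "i \<in> I" for P i x
      using g(1)[OF that(1)] that(2) by (simp add: graph_over_def)
    fix P Q and r :: real assume P: "P \<in> F" and Q: "Q \<in> F" and r: "0 < r"
    define \<mu> where "\<mu> = measure lborel {x \<in> cbox 0 1. norm ((A P x + b P) - (A Q x + b Q)) \<le> r}"
    have \<mu>: "\<mu> = measure lborel {x \<in> cbox 0 1. norm ((A P x - A Q x) + (b P - b Q)) \<le> r}"
      unfolding \<mu>_def by (simp add: algebra_simps)
    have "aff_dist P Q * \<mu> \<le> (2 + 2 * R) * (onorm (\<lambda>x. A P x - A Q x) + norm (b P - b Q)) * \<mu>"
      using P Q F g by (intro mult_right_mono aff_dist_le_graph_dist) (auto simp: \<mu>_def)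
    also have "\<dots> = (2 + 2 * R) * ((onorm (\<lambda>x. A P x - A Q x) + norm (b P - b Q)) * \<mu>)" by simp
    also have "\<dots> \<le> (2 + 2 * R) * (6 * (2 * real CARD('n) + 1) * 3 ^ CARD('n) * r)"
      unfolding \<mu> using R lin[OF P] lin[OF Q] r
      by (intro mult_left_mono measure_affine_sublevel linear_compose_sub) auto
    finally show "aff_dist P Q * measure lborel {x \<in> cbox 0 1. norm ((A P x + b P) - (A Q x + b Q)) \<le> r}
        \<le> (2 + 2 * R) * (6 * (2 * real CARD('n) + 1) * 3 ^ CARD('n)) * r"
      by (simp add: \<mu>_def mult.assoc)
  next
    show "0 \<le> (2 + 2 * R) * (6 * (2 * real CARD('n) + 1) * 3 ^ CARD('n))" using R by simp
  qed
qed

text \<open>The coordinate subspace over which a plane is a graph, and the size of its base point, depend on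
  the plane. Both are fixed on each of countably many pieces, and the null property is countably
  stable.\<close>

lemma null_at_family_of_null_union:
  fixes E :: "(real ^ 'n) set set"
  assumes E: "E \<subseteq> affine_grassmannian k" and t: "0 < t" "t < 1" and u: "0 < u" "u < t + real k"
    and N: "null_at UNIV dist u (\<Union>E)"
  shows "null_at (affine_grassmannian k) aff_dist t E"
proof -
  define piece where "piece p = {P \<in> E. \<exists>A b. graph_over (fst p) A b P \<and> norm b \<le> real (snd p)}"
    for p :: "'n set \<times> nat"
  define \<I> where "\<I> = {I :: 'n set. card I = k} \<times> (UNIV :: nat set)"
  have "null_at (affine_grassmannian k) aff_dist t (\<Union>p\<in>\<I>. piece p)"
  proof (rule null_at_UN_countable[OF t(1)])
    show "countable \<I>" unfolding \<I>_def by (intro countable_SIGMA) (auto intro: countable_finite)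
    fix p assume p: "p \<in> \<I>"
    obtain A b where g: "\<And>P. P \<in> piece p \<Longrightarrow> graph_over (fst p) (A P) (b P) P"
        "\<And>P. P \<in> piece p \<Longrightarrow> norm (b P) \<le> real (snd p)"
    proof -
      have "\<forall>P. \<exists>h. P \<in> piece p \<longrightarrow> graph_over (fst p) (fst h) (snd h) P \<and> norm (snd h) \<le> real (snd p)"
        by (auto simp: piece_def)
      then obtain h where "\<forall>P. P \<in> piece p \<longrightarrow> graph_over (fst p) (fst (h P)) (snd (h P)) P \<and> norm (snd (h P)) \<le> real (snd p)"
        by (rule exE[OF choice])
      then show ?thesis by (intro that[of "fst \<circ> h" "snd \<circ> h"]) auto
    qed
    have sub: "piece p \<subseteq> affine_grassmannian k" using E by (auto simp: piece_def)
    interpret transversal_family "piece p" aff_dist "\<lambda>P x. A P x + b P" "fst p"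
        "(2 + 2 * real (snd p)) * (6 * (2 * real CARD('n) + 1) * 3 ^ CARD('n))"
      by (rule transversal_family_graphs[OF sub _ g]) auto
    have "null_at (piece p) aff_dist t (piece p)"
    proof (rule null_at_of_null_union[OF t u(1) _ _ N])
      show "u < t + real (card (fst p))" using u p by (auto simp: \<I>_def)
      show "A P x + b P \<in> \<Union>E" if "P \<in> piece p" for P x
      proof -
        have "P \<in> E" "P \<in> affine_grassmannian k" using that sub by (auto simp: piece_def)
        then show ?thesis using graph_over_mem[OF _ g(1)[OF that]] by blast
      qed
    qed
    then show "null_at (affine_grassmannian k) aff_dist t (piece p)"
      by (rule null_at_lipschitz[OF t(1) zero_less_one _ sub]) simp
  qed
  moreover have "E \<subseteq> (\<Union>p\<in>\<I>. piece p)"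
  proof
    fix P assume P: "P \<in> E"
    then obtain I A b where I: "card I = k" "graph_over I A b P" using exists_graph_over E by blast
    obtain m :: nat where "norm b \<le> real m" using real_arch_simple by blast
    then have "P \<in> piece (I, m)" using P I by (auto simp: piece_def)
    then show "P \<in> (\<Union>p\<in>\<I>. piece p)" using I by (auto simp: \<I>_def)
  qed
  ultimately show ?thesis by (rule null_at_subset)
qed

lemma not_null_at_plane:
  assumes P: "P \<in> affine_grassmannian k" and u: "0 < u" "u \<le> real k"
  shows "\<not> null_at UNIV dist u P"
proof -
  obtain I A b where I: "card I = k" "graph_over I A b P" using exists_graph_over[OF P] by blast
  interpret transversal_family "{P}" aff_dist "\<lambda>P x. A x + b" I
      "(2 + 2 * norm b) * (6 * (2 * real CARD('a) + 1) * 3 ^ CARD('a))"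
    using P I by (intro transversal_family_graphs) auto
  show ?thesis
    using u I graph_over_mem[OF P I(2)] by (intro not_null_at_point_set[of P]) auto
qed

theorem theorem1p1:
  fixes k :: nat and s :: real
    and E :: "(real ^ 'n) set set"
    and \<rho> :: "(real ^ 'n) set \<Rightarrow> (real ^ 'n) set \<Rightarrow> real"
  assumes "1 \<le> k" and "k < CARD('n)"
    and "0 \<le> s" and "s \<le> 1"
    and "natural_metric k \<rho>"
    and "E \<subseteq> affine_grassmannian k" and "E \<noteq> {}"
    and "hausdorff_dim (affine_grassmannian k) \<rho> E = ennreal s"
  shows "hausdorff_dim UNIV dist (\<Union>E) = ennreal (s + real k)"
proof -
  let ?G = "affine_grassmannian k :: (real ^ 'n) set set"
  have dim: "Inf {ennreal t | t. 0 \<le> t \<and> hausdorff_measure ?G \<rho> t E = 0} = ennreal s"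
    using assms(8) by (simp add: hausdorff_dim_def)
  obtain K1 K2 where K: "0 < K1" "0 < K2"
    and K1: "\<And>P Q. P \<in> ?G \<Longrightarrow> Q \<in> ?G \<Longrightarrow> K1 * aff_dist P Q \<le> \<rho> P Q"
    and K2: "\<And>P Q. P \<in> ?G \<Longrightarrow> Q \<in> ?G \<Longrightarrow> \<rho> P Q \<le> K2 * aff_dist P Q"
    using assms(5) unfolding natural_metric_def by blast
  obtain P where P: "P \<in> E" "P \<in> ?G" using assms(6,7) by blast
  have "P \<noteq> {}" using P(2) by (auto simp: affine_grassmannian_def)
  then have ne: "\<Union>E \<noteq> {}" using P(1) by blast
  \<comment> \<open>The infimum that defines the dimension need not be attained, and the exponent \<open>0\<close> is ruled
    out because \<open>E\<close> is nonempty.\<close>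
  have above: "null_at ?G aff_dist t E" if "s < t" for t
  proof -
    have "Inf {ennreal t | t. 0 \<le> t \<and> hausdorff_measure ?G \<rho> t E = 0} < ennreal t"
      unfolding dim using that assms(3) by (simp add: ennreal_less_iff)
    then obtain t' where t': "0 \<le> t'" "hausdorff_measure ?G \<rho> t' E = 0" "ennreal t' < ennreal t"
      unfolding Inf_less_iff by blast
    then have "t' \<noteq> 0" using assms(7) hausdorff_measure_0_eq_0_iff by metis
    then have t'0: "0 < t'" using t'(1) by simp
    then have "null_at ?G \<rho> t' E" using t'(2) hausdorff_measure_eq_0_iff by blast
    then have N: "null_at ?G \<rho> t E"
      using t' t'0 by (intro null_at_mono_exponent[of t' t]) (auto simp: ennreal_less_iff)
    have le: "aff_dist P Q \<le> 1 / K1 * \<rho> P Q" if "P \<in> ?G" "Q \<in> ?G" for P Q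
      using K1[OF that] K(1) by (simp add: field_simps)
    have "0 < t" "0 < 1 / K1" using that assms(3) K(1) by simp_all
    then show ?thesis using N subset_refl le by (rule null_at_lipschitz)
  qed
  have below: "s \<le> t" if t: "0 < t" "null_at ?G aff_dist t E" for t
  proof -
    have "null_at ?G \<rho> t E"
      by (rule null_at_lipschitz[OF t(1) K(2) t(2) subset_refl K2])
    then have "hausdorff_measure ?G \<rho> t E = 0" using hausdorff_measure_eq_0_iff[OF t(1)] by blast
    then have "Inf {ennreal t | t. 0 \<le> t \<and> hausdorff_measure ?G \<rho> t E = 0} \<le> ennreal t"
      using t(1) by (intro Inf_lower) auto
    then show ?thesis unfolding dim using t(1) by simp
  qed
  have upper: "hausdorff_measure UNIV dist (t + real k) (\<Union>E) = 0" if "s < t" for t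
  proof -
    have t: "0 < t" using that assms(3) by simp
    have "null_at UNIV dist (t + real k) (\<Union>m::nat. \<Union>E \<inter> cball 0 (real m))"
      using t by (intro null_at_UN null_at_union_of_planes[OF assms(6) t _ above[OF that]]) auto
    moreover have "(\<Union>m::nat. \<Union>E \<inter> cball 0 (real m)) = \<Union>E"
      using real_arch_simple by auto
    ultimately show ?thesis using t by (subst hausdorff_measure_eq_0_iff) auto
  qed
  have lower: "s + real k \<le> u" if u: "0 \<le> u" "hausdorff_measure UNIV dist u (\<Union>E) = 0" for u
  proof (rule ccontr)
    assume "\<not> s + real k \<le> u"
    then have less: "u < s + real k" by simp
    have u0: "0 < u" using u ne hausdorff_measure_0_eq_0_iff by (metis order_le_less)
    then have N: "null_at UNIV dist u (\<Union>E)" using u(2) hausdorff_measure_eq_0_iff by blast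
    show False
    \<comment> \<open>Below \<open>k\<close>, and at \<open>s = 0\<close>, one plane suffices. Otherwise there is room for some
      \<open>t\<close> with \<open>u - k < t < s\<close>, and \<open>s \<le> 1\<close> makes \<open>t\<close> smaller than \<open>1\<close>.\<close>
    proof (cases "u < real k \<or> s = 0")
      case True
      then have "u \<le> real k" using less by auto
      moreover have "null_at UNIV dist u P" using N P(1) by (rule null_at_subset[OF _ Union_upper])
      ultimately show False using not_null_at_plane[OF P(2) u0] by blast
    next
      case False
      then have "u - real k < s" "0 \<le> u - real k" using less by auto
      then obtain t where t: "u - real k < t" "t < s" using dense by blast
      then have "0 < t" "t < 1" "u < t + real k" using \<open>0 \<le> u - real k\<close> assms(4) by auto
      then have "null_at ?G aff_dist t E" by (intro null_at_family_of_null_union[OF assms(6) _ _ u0 _ N])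
      then show False using below[OF \<open>0 < t\<close>] t(2) by simp
    qed
  qed
  show ?thesis
    unfolding hausdorff_dim_def
  proof (rule antisym)
    show "Inf {ennreal t |t. 0 \<le> t \<and> hausdorff_measure UNIV dist t (\<Union>E) = 0} \<le> ennreal (s + real k)"
    proof (rule ennreal_le_epsilon)
      fix e :: real assume e: "0 < e"
      have "Inf {ennreal t |t. 0 \<le> t \<and> hausdorff_measure UNIV dist t (\<Union>E) = 0} \<le> ennreal ((s + e) + real k)"
        using upper[of "s + e"] e assms(3)
        by (intro Inf_lower CollectI exI[of _ "(s + e) + real k"] conjI refl) auto
      also have "\<dots> = ennreal (s + real k) + ennreal e"
        using e assms(3) by (subst ennreal_plus[symmetric]) (auto simp: algebra_simps)
      finally show "Inf {ennreal t |t. 0 \<le> t \<and> hausdorff_measure UNIV dist t (\<Union>E) = 0} \<le> ennreal (s + real k) + ennreal e" .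
    qed
    show "ennreal (s + real k) \<le> Inf {ennreal t |t. 0 \<le> t \<and> hausdorff_measure UNIV dist t (\<Union>E) = 0}"
      using lower by (intro Inf_greatest) (auto intro!: ennreal_leI)
  qed
qed

end
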